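(* Let $X$ be a finite set of prototiles in $\mathbb{R}^d$ and let $T\in T(X)$ be a perfect tiling. Then there exist a finite set $X'$ of prototiles, each of which is a $d$-rectangle, and a perfect tiling $T'\in T(X')$ such that $T$ and $T'$ are $\Omega$-equivalent, i.e. there is a homeomorphism $\phi:\Omega_T\to\Omega_{T'}$ with $\phi(S+x)=\phi(S)+x$ for all $S\in\Omega_T$, $x\in\mathbb{R}^d$.
   Context: A prototile is a compact connected subset of $\mathbb{R}^d$ that is the closure of its interior. $X$ denotes a finite set of prototiles, pairwise not translates of each other. $T(X)$ is the set (assumed non-empty) of tilings of $\mathbb{R}^d$ by translates of elements of $X$: countable families of tiles covering $\mathbb{R}^d$ with pairwise disjoint interiors, each tile being a translate of an element of $X$. $\mathbb{R}^d$ acts on $T(X)$ by translation, $(x,T)\mapsto T+x$. Metric on $T(X)$: let $A$ be the set of $\epsilon\in(0,1)$ for which there are $x,x'$ with $\|x\|,\|x'\|\le\epsilon$ such that $T+x$ and $T'+x'$ coincide on the closed ball $B_{1/\epsilon}(0)$; set $\delta(T,T')=\inf A$ if $A\ne\emptyset$ and $\delta(T,T')=1$ otherwise. The continuous hull $\Omega_T$ is the closure of the orbit $T+\mathbb{R}^d$ in $(T(X),\delta)$; it is $\mathbb{R}^d$-invariant. A patch is a finite sub-collection of tiles of $T$. $T$ satisfies the finite pattern condition if for each $s>0$ there are, up to translation, only finitely many patches of diameter smaller than $s$. $T$ is repetitive if for every patch of $T$ there is $s>0$ such that every ball $B_s(x)$, $x\in\mathbb{R}^d$, contains a translate of this patch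 belonging to $T$. $T$ is aperiodic if $T+x=T$ implies $x=0$. $T$ is perfect if it is aperiodic, repetitive and satisfies the finite pattern condition. A $d$-rectangle is a product of $d$ non-degenerate compact intervals with respect to some orthonormal basis of $\mathbb{R}^d$. *)

theory Defs
  imports "HOL-Analysis.Analysis"
begin

text \<open>Prototiles are taken to be non-empty: the empty set satisfies the remaining conditions, but
  it would be an invisible tile.\<close>

definition prototile :: "'a::euclidean_space set \<Rightarrow> bool" where
  "prototile p \<longleftrightarrow> p \<noteq> {} \<and> compact p \<and> connected p \<and> closure (interior p) = p"

definition prototile_set :: "'a::euclidean_space set set \<Rightarrow> bool" where
  "prototile_set X \<longleftrightarrow> finite X \<and> (\<forall>p\<in>X. prototile p) \<and>
     (\<forall>p\<in>X. \<forall>q\<in>X. \<forall>x. q = (+) x ` p \<longrightarrow> p = q)"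

text \<open>A tiling is represented by the set of its tiles; since tiles have non-empty, pairwise disjoint
  interiors, no tile can be repeated in a family.\<close>

definition tilings :: "'a::euclidean_space set set \<Rightarrow> 'a set set set" where
  "tilings X = {T. countable T \<and> \<Union>T = UNIV \<and>
     (\<forall>t\<in>T. \<exists>p\<in>X. \<exists>x. t = (+) x ` p) \<and>
     (\<forall>s\<in>T. \<forall>t\<in>T. s \<noteq> t \<longrightarrow> interior s \<inter> interior t = {})}"

definition translate :: "'a::euclidean_space \<Rightarrow> 'a set set \<Rightarrow> 'a set set" where
  "translate x T = (\<lambda>t. (+) x ` t) ` T"

text \<open>Two tilings coincide on \<open>K\<close> if they have the same tiles meeting \<open>K\<close>.\<close>

definition coincide_on :: "'a set \<Rightarrow> 'a set set \<Rightarrow> 'a set set \<Rightarrow> bool" where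
  "coincide_on K T T' \<longleftrightarrow> {t\<in>T. t \<inter> K \<noteq> {}} = {t\<in>T'. t \<inter> K \<noteq> {}}"

definition close_eps :: "'a::euclidean_space set set \<Rightarrow> 'a set set \<Rightarrow> real set" where
  "close_eps T T' = {\<epsilon>. 0 < \<epsilon> \<and> \<epsilon> < 1 \<and> (\<exists>x x'. norm x \<le> \<epsilon> \<and> norm x' \<le> \<epsilon> \<and>
     coincide_on (cball 0 (1 / \<epsilon>)) (translate x T) (translate x' T'))}"

definition tiling_dist :: "'a::euclidean_space set set \<Rightarrow> 'a set set \<Rightarrow> real" where
  "tiling_dist T T' = (if close_eps T T' \<noteq> {} then Inf (close_eps T T') else 1)"

definition tiling_top :: "'a::euclidean_space set set \<Rightarrow> 'a set set topology" where
  "tiling_top X = Metric_space.mtopology (tilings X) tiling_dist"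

definition tiling_hull :: "'a::euclidean_space set set \<Rightarrow> 'a set set \<Rightarrow> 'a set set set" where
  "tiling_hull X T = tiling_top X closure_of (range (\<lambda>x. translate x T))"

definition patch :: "'a set set \<Rightarrow> 'a set set \<Rightarrow> bool" where
  "patch T P \<longleftrightarrow> finite P \<and> P \<subseteq> T"

definition translation_rel :: "('a::euclidean_space set set \<times> 'a set set) set" where
  "translation_rel = {(P, Q). \<exists>x. Q = translate x P}"

definition finite_pattern_condition :: "'a::euclidean_space set set \<Rightarrow> bool" where
  "finite_pattern_condition T \<longleftrightarrow>
     (\<forall>s>0. finite ({P. patch T P \<and> diameter (\<Union>P) < s} // translation_rel))"

definition repetitive :: "'a::euclidean_space set set \<Rightarrow> bool" where
  "repetitive T \<longleftrightarrow> (\<forall>P. patch T P \<longrightarrow>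
     (\<exists>s>0. \<forall>x. \<exists>y. translate y P \<subseteq> T \<and> \<Union>(translate y P) \<subseteq> cball x s))"

definition aperiodic :: "'a::euclidean_space set set \<Rightarrow> bool" where
  "aperiodic T \<longleftrightarrow> (\<forall>x. translate x T = T \<longrightarrow> x = 0)"

definition perfect :: "'a::euclidean_space set set \<Rightarrow> bool" where
  "perfect T \<longleftrightarrow> aperiodic T \<and> repetitive T \<and> finite_pattern_condition T"

definition hull_equivalent ::
  "'a::euclidean_space set set \<Rightarrow> 'a set set \<Rightarrow> 'a set set \<Rightarrow> 'a set set \<Rightarrow> bool" where
  "hull_equivalent X T X' T' \<longleftrightarrow> (\<exists>\<phi>.
     homeomorphic_map (subtopology (tiling_top X) (tiling_hull X T))
       (subtopology (tiling_top X') (tiling_hull X' T')) \<phi> \<and>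
     (\<forall>S\<in>tiling_hull X T. \<forall>x. \<phi> (translate x S) = translate x (\<phi> S)))"

text \<open>The edges are parallel to an orthonormal basis \<open>B\<close>, which may depend on the rectangle.\<close>

definition rectangle :: "'a::euclidean_space set \<Rightarrow> bool" where
  "rectangle R \<longleftrightarrow> (\<exists>B lo hi.
     pairwise orthogonal B \<and> (\<forall>b\<in>B. norm b = 1) \<and> span B = UNIV \<and>
     (\<forall>b\<in>B. lo b < hi b) \<and>
     R = {\<Sum>b\<in>B. c b *\<^sub>R b | c. \<forall>b\<in>B. c b \<in> {lo b..hi b}})"


text \<open>The distance is a metric on the tilings by a fixed set of prototiles, which is what gives
  \<^const>\<open>tiling_top\<close> its meaning.\<close>

lemma translate_translate: "translate x (translate y T) = translate (x + y) T"
  by (simp add: translate_def image_image add.assoc)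

lemma translate_0 [simp]: "translate 0 T = T"
  by (simp add: translate_def)

lemma coincide_on_translate:
  assumes "coincide_on (cball c r) T T'"
  shows "coincide_on (cball (c + x) r) (translate x T) (translate x T')"
proof -
  have *: "(+) x ` t \<inter> cball (c + x) r \<noteq> {} \<longleftrightarrow> t \<inter> cball c r \<noteq> {}" for t
  proof -
    have "(+) x ` t \<inter> cball (c + x) r = (+) x ` (t \<inter> cball c r)"
      by (auto simp: dist_norm algebra_simps)
    then show ?thesis by simp
  qed
  have "{t \<in> translate x S. t \<inter> cball (c + x) r \<noteq> {}}
      = (\<lambda>t. (+) x ` t) ` {t \<in> S. t \<inter> cball c r \<noteq> {}}" for S
    unfolding translate_def using * by fastforce
  then show ?thesis
    using assms unfolding coincide_on_def by simp
qed

lemma coincide_on_mono: "coincide_on K T T' \<Longrightarrow> L \<subseteq> K \<Longrightarrow> coincide_on L T T'"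
  unfolding coincide_on_def by (simp add: set_eq_iff) blast

lemma coincide_on_trans: "coincide_on K T T' \<Longrightarrow> coincide_on K T' T'' \<Longrightarrow> coincide_on K T T''"
  unfolding coincide_on_def by simp

lemma bdd_below_close_eps: "bdd_below (close_eps T T')"
  by (rule bdd_belowI[of _ 0]) (auto simp: close_eps_def)

lemma tiling_dist_lt:
  assumes "tiling_dist T T' < e" "e \<le> 1"
  obtains \<epsilon> where "\<epsilon> \<in> close_eps T T'" "\<epsilon> < e"
  using assms cInf_lessD[of "close_eps T T'" e] by (auto simp: tiling_dist_def split: if_splits)

lemma tiling_dist_le: "\<epsilon> \<in> close_eps T T' \<Longrightarrow> tiling_dist T T' \<le> \<epsilon>"
  by (auto simp: tiling_dist_def intro: cInf_lower bdd_below_close_eps)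

lemma tiling_dist_nonneg: "0 \<le> tiling_dist T T'"
  by (auto simp: tiling_dist_def close_eps_def intro!: cInf_greatest)

lemma tiling_dist_le_1: "tiling_dist T T' \<le> 1"
proof (cases "close_eps T T' = {}")
  case False
  then obtain \<epsilon> where e: "\<epsilon> \<in> close_eps T T'" by blast
  then have "\<epsilon> < 1" by (auto simp: close_eps_def)
  then show ?thesis using tiling_dist_le[OF e] by simp
qed (simp add: tiling_dist_def)

lemma close_eps_commute: "close_eps T T' = close_eps T' T"
  unfolding close_eps_def coincide_on_def by (auto; metis)

lemma close_eps_add:
  assumes "\<epsilon> \<in> close_eps T T'" "\<eta> \<in> close_eps T' T''" "\<epsilon> + \<eta> < 1"
  shows "\<epsilon> + \<eta> \<in> close_eps T T''"
proof -
  obtain x x' where x: "norm x \<le> \<epsilon>" "norm x' \<le> \<epsilon>" "0 < \<epsilon>"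
    and cx: "coincide_on (cball 0 (1 / \<epsilon>)) (translate x T) (translate x' T')"
    using assms(1) by (auto simp: close_eps_def)
  obtain y y' where y: "norm y \<le> \<eta>" "norm y' \<le> \<eta>" "0 < \<eta>"
    and cy: "coincide_on (cball 0 (1 / \<eta>)) (translate y T') (translate y' T'')"
    using assms(2) by (auto simp: close_eps_def)
  have rad: "1 / (a + b) + b \<le> 1 / a" if "0 < a" "0 < b" "a + b < 1" for a b :: real
  proof -
    have "a * (a + b) \<le> 1"
      using that by (intro mult_le_one) auto
    then have "b * (a * (a + b)) \<le> b" using that by (simp add: mult_left_le)
    then show ?thesis using that by (simp add: field_simps)
  qed
  let ?K = "cball (0::'a) (1 / (\<epsilon> + \<eta>))"
  have "coincide_on (cball (0 + y) (1 / \<epsilon>)) (translate (y + x) T) (translate (y + x') T')"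
    using coincide_on_translate[OF cx, of y] by (simp add: translate_translate)
  moreover have "?K \<subseteq> cball (0 + y) (1 / \<epsilon>)"
    using rad[of \<epsilon> \<eta>] x y assms(3) by (simp add: cball_subset_cball_iff dist_norm)
  ultimately have 1: "coincide_on ?K (translate (y + x) T) (translate (y + x') T')"
    by (rule coincide_on_mono)
  have "coincide_on (cball (0 + x') (1 / \<eta>)) (translate (x' + y) T') (translate (x' + y') T'')"
    using coincide_on_translate[OF cy, of x'] by (simp add: translate_translate)
  moreover have "?K \<subseteq> cball (0 + x') (1 / \<eta>)"
    using rad[of \<eta> \<epsilon>] x y assms(3) by (simp add: cball_subset_cball_iff dist_norm add.commute)
  ultimately have 2: "coincide_on ?K (translate (x' + y) T') (translate (x' + y') T'')"
    by (rule coincide_on_mono)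
  have "coincide_on ?K (translate (y + x) T) (translate (x' + y') T'')"
    using coincide_on_trans[OF 1] 2 by (simp add: add.commute)
  moreover have "norm (y + x) \<le> \<epsilon> + \<eta>" "norm (x' + y') \<le> \<epsilon> + \<eta>"
    using x y norm_triangle_ineq[of y x] norm_triangle_ineq[of x' y'] by linarith+
  ultimately show ?thesis
    using x y assms(3) unfolding close_eps_def by (simp, blast)
qed

lemma compact_translate_eq_imp_0:
  fixes t :: "'a::euclidean_space set"
  assumes "compact t" "t \<noteq> {}" "(+) u ` t = t"
  shows "u = 0"
proof -
  have "continuous_on t (\<lambda>b. b \<bullet> u)" by (intro continuous_intros)
  then obtain a where a: "a \<in> t" "\<And>b. b \<in> t \<Longrightarrow> b \<bullet> u \<le> a \<bullet> u"
    using continuous_attains_sup[OF assms(1,2)] by blast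
  have "u + a \<in> t" using a(1) assms(3) by blast
  then have "u \<bullet> u \<le> 0" using a(2)[of "u + a"] by (simp add: inner_add_left)
  then show ?thesis by (metis inner_eq_zero_iff inner_ge_zero antisym)
qed

lemma tiling_dist_zero_imp_subset:
  assumes X: "prototile_set X" and T: "T \<in> tilings X" and T': "T' \<in> tilings X"
    and z: "tiling_dist T T' = 0"
  shows "T \<subseteq> T'"
proof
  fix t assume t: "t \<in> T"
  obtain p v where pv: "p \<in> X" "t = (+) v ` p" using T t by (auto simp: tilings_def)
  then have p: "prototile p" using X by (simp add: prototile_set_def)
  have cpt: "compact t" and ne: "t \<noteq> {}" and int: "interior t \<noteq> {}"
    using p pv by (auto simp: prototile_def interior_translation compact_translation)
  obtain c where c0: "c \<in> interior t" using int by blast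
  then obtain r where r: "0 < r" "ball c r \<subseteq> interior t"
    using open_contains_ball open_interior by blast
  have c: "c \<in> t" using c0 interior_subset by blast
  have near: "\<exists>u. norm u < e \<and> (+) u ` t \<in> T'" if "0 < e" for e :: real
  proof -
    define d where "d = min (e / 2) (min 1 (1 / (norm c + 1)))"
    have d: "0 < d" "d \<le> 1" "d \<le> e / 2" "d \<le> 1 / (norm c + 1)"
      using that by (auto simp: d_def min_le_iff_disj divide_le_eq_1 add_nonneg_pos)
    obtain \<epsilon> where e: "\<epsilon> \<in> close_eps T T'" "\<epsilon> < d"
      using tiling_dist_lt[of T T' d] z d by auto
    then obtain x x' where x: "norm x \<le> \<epsilon>" "norm x' \<le> \<epsilon>" "0 < \<epsilon>"
      and cx: "coincide_on (cball 0 (1 / \<epsilon>)) (translate x T) (translate x' T')"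
      by (auto simp: close_eps_def)
    have "\<epsilon> \<le> 1 / (norm c + 1)" using e d by linarith
    then have "norm c + 1 \<le> 1 / \<epsilon>" using x by (simp add: field_simps add_pos_nonneg)
    moreover have "norm (x + c) \<le> norm c + 1"
      using norm_triangle_ineq[of x c] x e d by linarith
    ultimately have "x + c \<in> (+) x ` t \<inter> cball 0 (1 / \<epsilon>)" using c by simp
    moreover have "(+) x ` t \<in> translate x T" using t by (simp add: translate_def)
    ultimately have "(+) x ` t \<in> translate x' T'"
      using cx unfolding coincide_on_def by blast
    then obtain t' where t': "t' \<in> T'" "(+) x ` t = (+) x' ` t'" by (auto simp: translate_def)
    have "(+) (- x') ` ((+) x ` t) = t'" by (simp add: t'(2) image_image)
    then have "(+) (x - x') ` t = t'" by (simp add: image_image algebra_simps)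
    moreover have "norm (x - x') < e"
      using norm_triangle_ineq4[of x x'] x e d by linarith
    ultimately show ?thesis using t'(1) by blast
  qed
  have uniq: "u = w" if "norm u < r" "norm w < r" "(+) u ` t \<in> T'" "(+) w ` t \<in> T'" for u w
  proof -
    have "c \<in> interior ((+) u ` t)" if "norm u < r" for u
    proof -
      have "c - u \<in> interior t" using r that by (auto simp: dist_norm)
      then have "u + (c - u) \<in> (+) u ` interior t" by blast
      then show ?thesis by (simp add: interior_translation)
    qed
    then have "interior ((+) u ` t) \<inter> interior ((+) w ` t) \<noteq> {}" using that by blast
    then have "(+) u ` t = (+) w ` t" using T' that unfolding tilings_def by blast
    then have "(+) (- w) ` ((+) u ` t) = (+) (- w) ` ((+) w ` t)" by simp
    then have "(+) (u - w) ` t = t" by (simp add: image_image algebra_simps)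
    then show ?thesis using compact_translate_eq_imp_0[OF cpt ne] by force
  qed
  obtain u where u: "norm u < r" "(+) u ` t \<in> T'" using near r by blast
  have "u = 0"
  proof (rule ccontr)
    assume "u \<noteq> 0"
    then obtain w where "norm w < norm u" "(+) w ` t \<in> T'" using near[of "norm u"] by auto
    then show False using uniq[of u w] u by auto
  qed
  then show "t \<in> T'" using u by simp
qed

lemma tiling_dist_refl: "tiling_dist T T = 0"
proof (rule antisym[OF _ tiling_dist_nonneg], rule field_le_epsilon)
  fix e :: real assume "0 < e"
  define d where "d = min e (1 / 2)"
  have "d \<in> close_eps T T"
    using \<open>0 < e\<close> unfolding close_eps_def coincide_on_def d_def
    by (intro CollectI conjI exI[of _ 0]) auto
  then show "tiling_dist T T \<le> 0 + e" using tiling_dist_le by (fastforce simp: d_def)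
qed

lemma Metric_space_tilings:
  assumes X: "prototile_set X"
  shows "Metric_space (tilings X) tiling_dist"
proof
  show "tiling_dist T T' = tiling_dist T' T" for T T' :: "'a set set"
    by (simp add: tiling_dist_def close_eps_commute)
  then show "tiling_dist T T' = 0 \<longleftrightarrow> T = T'" if "T \<in> tilings X" "T' \<in> tilings X" for T T'
    using tiling_dist_zero_imp_subset[OF X] that tiling_dist_refl by (metis subset_antisym)
  show "tiling_dist T T'' \<le> tiling_dist T T' + tiling_dist T' T''" for T T' T'' :: "'a set set"
  proof (rule field_le_epsilon)
    fix e :: real assume e: "0 < e"
    let ?a = "tiling_dist T T'" and ?b = "tiling_dist T' T''"
    show "tiling_dist T T'' \<le> ?a + ?b + e"
    proof (cases "?a + ?b + e < 1")
      case True
      obtain \<epsilon> where 1: "\<epsilon> \<in> close_eps T T'" "\<epsilon> < ?a + e / 2"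
        using tiling_dist_lt[of T T' "?a + e / 2"] True e tiling_dist_nonneg[of T' T''] by auto
      obtain \<eta> where 2: "\<eta> \<in> close_eps T' T''" "\<eta> < ?b + e / 2"
        using tiling_dist_lt[of T' T'' "?b + e / 2"] True e tiling_dist_nonneg[of T T'] by auto
      have "\<epsilon> + \<eta> \<in> close_eps T T''" using close_eps_add 1 2 True by fastforce
      then show ?thesis using tiling_dist_le 1 2 by fastforce
    next
      case False
      then show ?thesis using tiling_dist_le_1[of T T''] by linarith
    qed
  qed
qed (rule tiling_dist_nonneg)

end

(* If two tilings are obtained from each other by translation-equivariant rules of finite range, their
   hulls are equivariantly homeomorphic and perfection is inherited, so it suffices to derive locally
   from T a tiling T' by rectangles from which T can be recovered locally.

   Put a half-open cube of side L, larger than all tiles, at the lower corner of every tile of T.  These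
   cubes cover space, and cutting by the face hyperplanes of all cubes close to those that contain a
   given point partitions space into half-open rectangles ("cells"), each contained in a constant set of
   cubes.  Up to translation there are only finitely many pairs (cell, set of tiles whose cubes contain
   it).  Since tiles carry no labels, this pair is encoded geometrically: each cell is split by a
   hyperplane orthogonal to a fixed axis k, at a distance from its lower face which is a different small
   number for each pair.  The left part of a cell then tells the pair by its width. *)

theory Submission
  imports Defs
begin

section \<open>Tilings\<close>

text \<open>The hull contains tilings that are not translates of \<open>T\<close>, while the list of
  pairs used for decoding is read off from \<open>T\<close> alone. Both rules are therefore total
  functions on collections of sets, and only the identity \<open>G (F T) = T\<close> is computed
  directly: equivariance spreads it to the orbit, and finite range spreads it to the closure. Cubes
  stand in for the tiles because tiles may have any shape, whereas the componentwise infimum of a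
  tile commutes with translation and yields faces in fixed coordinate directions. Cells of equal
  shape may belong to different sets of tiles, yet rectangles of equal size are one and the same
  prototile; this is why the extra information has to be turned into a length. A left part must be
  told apart from right parts too, so the lengths are chosen below half of the least cell width. A
  positive least width, and a finite set of rectangles, come from the finiteness of the pairs, which
  is where the finite pattern condition enters the construction.\<close>

lemma mem_translate_iff: "t \<in> translate x S \<longleftrightarrow> (+) (- x) ` t \<in> S"
proof
  assume "(+) (- x) ` t \<in> S"
  then have "(+) x ` ((+) (- x) ` t) \<in> translate x S" unfolding translate_def by blast
  then show "t \<in> translate x S" by (simp add: image_image)
qed (auto simp: translate_def image_image)

lemma Union_translate: "\<Union>(translate x P) = (+) x ` \<Union>P"
  by (auto simp: translate_def)

lemma translate_mono: "P \<subseteq> Q \<Longrightarrow> translate x P \<subseteq> translate x Q"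
  by (auto simp: translate_def)

lemma finite_translate: "finite P \<Longrightarrow> finite (translate x P)"
  by (simp add: translate_def)

lemma prototile_translation: "prototile p \<Longrightarrow> prototile ((+) x ` p)"
  by (auto simp: prototile_def compact_translation interior_translation closure_translation
      intro!: connected_continuous_image continuous_intros)

lemma tile_prototile:
  assumes "prototile_set X" "T \<in> tilings X" "t \<in> T"
  shows "prototile t"
proof -
  obtain p x where "p \<in> X" "t = (+) x ` p" using assms(2,3) by (auto simp: tilings_def)
  then show ?thesis using assms(1) prototile_translation by (auto simp: prototile_set_def)
qed

lemma empty_notin_tiling: "prototile_set X \<Longrightarrow> T \<in> tilings X \<Longrightarrow> {} \<notin> T"
  using tile_prototile prototile_def by blast

lemma translate_in_tilings:
  assumes "T \<in> tilings X"
  shows "translate x T \<in> tilings X"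
proof -
  have "\<exists>p\<in>X. \<exists>y. (+) x ` t = (+) y ` p" if "t \<in> T" for t
  proof -
    obtain p y where "p \<in> X" "t = (+) y ` p" using assms \<open>t \<in> T\<close> by (auto simp: tilings_def)
    then have "(+) x ` t = (+) (x + y) ` p" by (simp add: image_image add.assoc)
    then show ?thesis using \<open>p \<in> X\<close> by blast
  qed
  moreover have "interior ((+) x ` s) \<inter> interior ((+) x ` t) = {}"
    if "s \<in> T" "t \<in> T" "(+) x ` s \<noteq> (+) x ` t" for s t
  proof -
    have "s \<noteq> t" using that by blast
    then have "interior s \<inter> interior t = {}" using that assms by (simp add: tilings_def)
    moreover have "(+) x ` interior s \<inter> (+) x ` interior t = (+) x ` (interior s \<inter> interior t)"
      by auto
    ultimately show ?thesis unfolding interior_translation by simp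
  qed
  moreover have "\<Union>(translate x T) = UNIV"
    unfolding Union_translate using assms by (simp add: tilings_def)
  moreover have "countable (translate x T)"
    using assms by (simp add: tilings_def translate_def)
  ultimately show ?thesis unfolding tilings_def translate_def by blast
qed

text \<open>Every tile is a translate of one of finitely many prototiles, so an inscribed radius and
  a diameter bound can be chosen once for all tilings.\<close>

lemma tiles_uniform:
  fixes X :: "'a::euclidean_space set set"
  assumes X: "prototile_set X"
  obtains \<rho> D where "0 < \<rho>" "0 < D"
    "\<And>T t. T \<in> tilings X \<Longrightarrow> t \<in> T \<Longrightarrow> \<exists>c. c \<in> t \<and> ball c \<rho> \<subseteq> interior t"
    "\<And>T t u v. T \<in> tilings X \<Longrightarrow> t \<in> T \<Longrightarrow> u \<in> t \<Longrightarrow> v \<in> t \<Longrightarrow> dist u v \<le> D"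
proof -
  have fin: "finite X" and pt: "\<And>p. p \<in> X \<Longrightarrow> prototile p"
    using X by (auto simp: prototile_set_def)
  have "\<exists>r>0. \<exists>c. c \<in> p \<and> ball c r \<subseteq> interior p" if "p \<in> X" for p
  proof -
    have "interior p \<noteq> {}" using pt[OF that] by (auto simp: prototile_def)
    then obtain c where "c \<in> interior p" by blast
    then show ?thesis using open_contains_ball[of "interior p"] interior_subset by blast
  qed
  then obtain r where r: "\<And>p. p \<in> X \<Longrightarrow> 0 < r p \<and> (\<exists>c. c \<in> p \<and> ball c (r p) \<subseteq> interior p)"
    by metis
  \<comment> \<open>The element 1 keeps \<open>Min\<close> meaningful when \<open>X\<close> is
    empty.\<close>
  define \<rho> where "\<rho> = Min (insert 1 (r ` X))"
  have \<rho>: "0 < \<rho>" "\<And>p. p \<in> X \<Longrightarrow> \<rho> \<le> r p" using fin r by (auto simp: \<rho>_def)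
  have "bounded (\<Union>p\<in>X. p)" using fin pt by (auto simp: prototile_def compact_imp_bounded)
  then obtain B where B: "0 < B" "\<And>u. u \<in> (\<Union>p\<in>X. p) \<Longrightarrow> norm u \<le> B"
    unfolding bounded_pos by blast
  show ?thesis
  proof
    show "0 < \<rho>" "0 < 2 * B" using \<rho> B by auto
    fix T t assume T: "T \<in> tilings X" "t \<in> T"
    then obtain p x where p: "p \<in> X" "t = (+) x ` p" by (auto simp: tilings_def)
    show "\<exists>c. c \<in> t \<and> ball c \<rho> \<subseteq> interior t"
    proof -
      obtain c where c: "c \<in> p" "ball c (r p) \<subseteq> interior p" using r p by blast
      have "ball (x + c) \<rho> \<subseteq> (+) x ` ball c (r p)"
      proof
        fix y assume "y \<in> ball (x + c) \<rho>"
        then have "y - x \<in> ball c (r p)"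
          using \<rho>(2)[OF p(1)] by (simp add: dist_norm algebra_simps)
        then have "x + (y - x) \<in> (+) x ` ball c (r p)" by blast
        then show "y \<in> (+) x ` ball c (r p)" by simp
      qed
      also have "\<dots> \<subseteq> interior t"
        unfolding p(2) interior_translation by (rule image_mono[OF c(2)])
      finally show ?thesis using c p by blast
    qed
    fix u v assume "u \<in> t" "v \<in> t"
    then obtain u' v' where "u = x + u'" "v = x + v'" "u' \<in> p" "v' \<in> p" using p by auto
    moreover from this have "norm u' \<le> B" "norm v' \<le> B" using B p by auto
    ultimately show "dist u v \<le> 2 * B"
      using norm_triangle_ineq4[of u' v'] by (simp add: dist_norm)
  qed
qed

text \<open>The centres of inscribed balls of different tiles are at least \<open>\<rho>\<close>
  apart, since the interiors are disjoint; a separated set inside a bounded region is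
  finite.\<close>

lemma finite_tiles_meeting:
  fixes X :: "'a::euclidean_space set set"
  assumes X: "prototile_set X" and T: "T \<in> tilings X"
  shows "finite {t \<in> T. t \<inter> cball x r \<noteq> {}}" (is "finite ?F")
proof -
  obtain \<rho> D where u: "0 < \<rho>" "0 < D"
    "\<And>t. t \<in> T \<Longrightarrow> \<exists>c. c \<in> t \<and> ball c \<rho> \<subseteq> interior t"
    "\<And>t u v. t \<in> T \<Longrightarrow> u \<in> t \<Longrightarrow> v \<in> t \<Longrightarrow> dist u v \<le> D"
    using tiles_uniform[OF X] T by metis
  obtain c where c: "\<And>t. t \<in> T \<Longrightarrow> c t \<in> t \<and> ball (c t) \<rho> \<subseteq> interior t" using u(3) by metis
  have sep: "s = t" if "s \<in> T" "t \<in> T" "dist (c s) (c t) < \<rho>" for s t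
  proof -
    have "c t \<in> ball (c s) \<rho>" "c t \<in> ball (c t) \<rho>" using that u(1) by auto
    then have "c t \<in> interior s \<inter> interior t" using c that by blast
    then show ?thesis using T that unfolding tilings_def by blast
  qed
  then have inj: "inj_on c ?F" using u(1) by (auto simp: inj_on_def)
  have "uniform_discrete (c ` ?F)" unfolding uniform_discrete_def using u(1) sep by blast
  moreover have "c ` ?F \<subseteq> cball x (r + D)"
  proof
    fix y assume "y \<in> c ` ?F"
    then obtain t v where t: "t \<in> T" "v \<in> t" "v \<in> cball x r" "y = c t" by blast
    then have "dist v y \<le> D" using c u(4) by blast
    then show "y \<in> cball x (r + D)" using t dist_triangle[of x y v] by simp
  qed
  ultimately have "finite (c ` ?F)"
    using uniform_discrete_finite_iff bounded_subset[OF bounded_cball] by metis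
  then show ?thesis using finite_imageD inj by blast
qed

text \<open>A tile is the closure of its interior. This turns mere contact into overlap, to which
  disjointness of interiors can be applied.\<close>

lemma tile_meets_interior:
  assumes X: "prototile_set X" and T: "T \<in> tilings X" "t \<in> T" and U: "open U" "t \<inter> U \<noteq> {}"
  shows "interior t \<inter> U \<noteq> {}"
proof -
  have "closure (interior t) = t" using tile_prototile[OF X T] by (simp add: prototile_def)
  then show ?thesis using U open_Int_closure_eq_empty[of U "interior t"] by (simp add: Int_commute)
qed

text \<open>The margin 1 is needed because a tile may touch a ball only in a boundary point.\<close>

lemma coincide_on_of_subset:
  fixes X :: "'a::euclidean_space set set"
  assumes X: "prototile_set X" and T: "T \<in> tilings X" and T': "T' \<in> tilings X"
    and sub: "{t \<in> T. t \<inter> cball x (r + 1) \<noteq> {}} \<subseteq> T'"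
  shows "coincide_on (cball x r) T T'"
proof -
  have "t \<in> T" if t: "t \<in> T'" "t \<inter> cball x r \<noteq> {}" for t
  proof -
    have "t \<inter> ball x (r + 1) \<noteq> {}" using t(2) by force
    \<comment> \<open>An interior point of \<open>t\<close> in the larger ball lies in some tile
      \<open>s\<close> of \<open>T\<close>. By \<open>sub\<close> this \<open>s\<close> is also in
      \<open>T'\<close>, and two overlapping tiles of \<open>T'\<close> are equal.\<close>
    then obtain u where u: "u \<in> interior t" "u \<in> ball x (r + 1)"
      using tile_meets_interior[OF X T' t(1) open_ball] by blast
    have "u \<in> \<Union>T" using T by (simp add: tilings_def)
    then obtain s where s: "s \<in> T" "u \<in> s" by blast
    have "u \<in> s \<inter> cball x (r + 1)" using s u by simp
    then have "s \<in> T'" using sub s by blast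
    have "interior s \<inter> interior t \<noteq> {}"
      using tile_meets_interior[OF X T s(1) open_interior[of t]] s u by blast
    then have "s = t" using T' \<open>s \<in> T'\<close> t unfolding tilings_def by blast
    then show ?thesis using s by simp
  qed
  moreover have "t \<in> T'" if "t \<in> T" "t \<inter> cball x r \<noteq> {}" for t
  proof -
    have "t \<inter> cball x (r + 1) \<noteq> {}" using that(2) by force
    then show ?thesis using that sub by blast
  qed
  ultimately show ?thesis unfolding coincide_on_def by blast
qed

text \<open>Coincidence only sees sets that meet the ball. The empty set meets none, which is why it
  has to be excluded.\<close>

lemma subset_of_coincide_on_balls:
  fixes S :: "'a::euclidean_space set set"
  assumes "\<And>r. coincide_on (cball 0 r) S S'" "{} \<notin> S"
  shows "S \<subseteq> S'"
proof
  fix t assume t: "t \<in> S"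
  then obtain u where "u \<in> t" using assms(2) by (cases "t = {}") auto
  then have "t \<inter> cball 0 (norm u) \<noteq> {}" by auto
  then show "t \<in> S'" using assms(1)[of "norm u"] t unfolding coincide_on_def by blast
qed

lemma coincide_on_sym: "coincide_on K S S' \<Longrightarrow> coincide_on K S' S"
  by (simp add: coincide_on_def)

text \<open>Covering, shape and disjointness each concern one point or at most two members, hence
  are visible in a bounded region; countability follows by exhausting space with balls. This
  provides membership in \<open>tilings X\<close> for images of hull elements.\<close>

lemma tilings_closed:
  fixes X :: "'a::euclidean_space set set"
  assumes X: "prototile_set X" and ne: "{} \<notin> S"
    and loc: "\<And>r. \<exists>T\<in>tilings X. coincide_on (cball 0 r) S T"
  shows "S \<in> tilings X"
proof -
  have mem: "t \<in> T" if "coincide_on (cball 0 r) S T" "t \<in> S" "u \<in> t" "norm u \<le> r" for r t u T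
  proof -
    have "u \<in> t \<inter> cball 0 r" using that by simp
    then show ?thesis using that unfolding coincide_on_def by blast
  qed
  have cn: "countable {t \<in> S. t \<inter> cball 0 (real n) \<noteq> {}}" for n
  proof -
    obtain T where T: "T \<in> tilings X" "coincide_on (cball 0 (real n)) S T" using loc by blast
    have "{t \<in> S. t \<inter> cball 0 (real n) \<noteq> {}} \<subseteq> T" using T(2) unfolding coincide_on_def by blast
    moreover have "countable T" using T(1) by (simp add: tilings_def)
    ultimately show ?thesis by (rule countable_subset)
  qed
  have "S \<subseteq> (\<Union>n. {t \<in> S. t \<inter> cball 0 (real n) \<noteq> {}})"
  proof
    fix t assume t: "t \<in> S"
    then obtain u where "u \<in> t" using ne by (cases "t = {}") auto
    moreover obtain n :: nat where "norm u \<le> n" using real_arch_simple by blast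
    ultimately have "u \<in> t \<inter> cball 0 (real n)" by simp
    then show "t \<in> (\<Union>n. {t \<in> S. t \<inter> cball 0 (real n) \<noteq> {}})" using t by blast
  qed
  then have 1: "countable S"
    by (rule countable_subset) (intro countable_UN countableI_type cn)
  have "u \<in> \<Union>S" for u
  proof -
    obtain T where T: "T \<in> tilings X" "coincide_on (cball 0 (norm u)) S T" using loc by blast
    then have "u \<in> \<Union>T" by (simp add: tilings_def)
    then obtain t where t: "t \<in> T" "u \<in> t" by blast
    then have "u \<in> t \<inter> cball 0 (norm u)" by simp
    then show ?thesis using T(2) t unfolding coincide_on_def by blast
  qed
  then have 2: "\<Union>S = UNIV" by blast
  have 3: "\<exists>p\<in>X. \<exists>x. t = (+) x ` p" if t: "t \<in> S" for t
  proof -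
    obtain u where u: "u \<in> t" using t ne by (cases "t = {}") auto
    obtain T where T: "T \<in> tilings X" "coincide_on (cball 0 (norm u)) S T" using loc by blast
    then show ?thesis using mem[OF T(2) t u] by (auto simp: tilings_def)
  qed
  have 4: "interior s \<inter> interior t = {}" if st: "s \<in> S" "t \<in> S" "s \<noteq> t" for s t
  proof -
    have "s \<noteq> {}" "t \<noteq> {}" using st ne by auto
    then obtain u v where u: "u \<in> s" "v \<in> t" by blast
    obtain T where T: "T \<in> tilings X" "coincide_on (cball 0 (max (norm u) (norm v))) S T"
      using loc by blast
    have "s \<in> T" "t \<in> T" using mem[OF T(2) _ u(1)] mem[OF T(2) _ u(2)] st by auto
    then show ?thesis using T(1) st(3) by (simp add: tilings_def)
  qed
  show ?thesis using 1 2 3 4 by (simp add: tilings_def)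
qed

text \<open>The two small shifts in the metric disappear: undoing the shift of \<open>S\<close>
  costs less than one unit of radius, and the other shift only selects another orbit element. Later
  arguments use this description and avoid the metric.\<close>

lemma tiling_hull_eq:
  fixes X :: "'a::euclidean_space set set"
  assumes X: "prototile_set X" and T: "T \<in> tilings X"
  shows "tiling_hull X T =
    {S \<in> tilings X. \<forall>r. \<exists>x. coincide_on (cball 0 r) S (translate x T)}"
proof -
  interpret Metric_space "tilings X" tiling_dist by (rule Metric_space_tilings[OF X])
  have "(\<forall>e>0. \<exists>R\<in>range (\<lambda>x. translate x T). R \<in> mball S e) \<longleftrightarrow>
      (\<forall>r. \<exists>x. coincide_on (cball 0 r) S (translate x T))" (is "?L \<longleftrightarrow> ?R")
    if S: "S \<in> tilings X" for S
  proof
    assume L: ?L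
    show ?R
    proof
      fix r :: real
      \<comment> \<open>The radius \<open>1 / e\<close> exceeds \<open>r + 1\<close>, where the
        extra unit pays for recentring by \<open>x\<close>; \<open>max r 0\<close> covers negative
        \<open>r\<close>.\<close>
      define e where "e = 1 / (max r 0 + 2)"
      have e: "0 < e" "e < 1" "r + 1 < 1 / e" by (auto simp: e_def)
      obtain z where "translate z T \<in> mball S e" using L e(1) by blast
      then have "tiling_dist S (translate z T) < e" by simp
      then obtain d where d: "d \<in> close_eps S (translate z T)" "d < e"
        using tiling_dist_lt e(2) by (metis less_le)
      then obtain x x' where x: "norm x \<le> d" "0 < d"
        and cx: "coincide_on (cball 0 (1 / d)) (translate x S) (translate x' (translate z T))"
        by (auto simp: close_eps_def)
      have "coincide_on (cball (0 + - x) (1 / d)) (translate (- x) (translate x S))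
          (translate (- x) (translate x' (translate z T)))"
        by (rule coincide_on_translate[OF cx])
      then have c: "coincide_on (cball (- x) (1 / d)) S (translate (- x + x' + z) T)"
        by (simp add: translate_translate algebra_simps)
      have "1 / e < 1 / d" using x d e by (simp add: frac_less2)
      then have "r + norm x \<le> 1 / d" using x d(2) e(2,3) by linarith
      then have "cball 0 r \<subseteq> cball (- x) (1 / d)" by (simp add: cball_subset_cball_iff dist_norm)
      then show "\<exists>x. coincide_on (cball 0 r) S (translate x T)"
        using coincide_on_mono[OF c] by blast
    qed
  next
    assume R: ?R
    show ?L
    proof (intro allI impI)
      fix e :: real assume "0 < e"
      define d where "d = min (e / 2) (1 / 2)"
      have d: "0 < d" "d < 1" "d < e" using \<open>0 < e\<close> by (auto simp: d_def)
      obtain x where "coincide_on (cball 0 (1 / d)) S (translate x T)" using R by blast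
      then have "d \<in> close_eps S (translate x T)"
        using d unfolding close_eps_def by (intro CollectI conjI exI[of _ 0]) auto
      then have "translate x T \<in> mball S e"
        using tiling_dist_le d(3) S translate_in_tilings[OF T] by (fastforce simp: mball_def)
      then show "\<exists>R\<in>range (\<lambda>x. translate x T). R \<in> mball S e" by blast
    qed
  qed
  then show ?thesis unfolding tiling_hull_def tiling_top_def metric_closure_of by blast
qed

section \<open>Local derivations\<close>

text \<open>Locality is required for arbitrary collections of sets rather than for tilings only, so that no
  tiling hypotheses have to be carried along.\<close>

definition local_derivation :: "('a::euclidean_space set set \<Rightarrow> 'a set set) \<Rightarrow> real \<Rightarrow> bool" where
  "local_derivation F R \<longleftrightarrow> 0 \<le> R \<and> (\<forall>S. {} \<notin> F S) \<and>
     (\<forall>S x. F (translate x S) = translate x (F S)) \<and>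
     (\<forall>S S' x r. coincide_on (cball x (r + R)) S S' \<longrightarrow> coincide_on (cball x r) (F S) (F S'))"

lemma local_derivationD:
  assumes "local_derivation F R"
  shows "0 \<le> R" "{} \<notin> F S" "F (translate x S) = translate x (F S)"
    "coincide_on (cball x (r + R)) S S' \<Longrightarrow> coincide_on (cball x r) (F S) (F S')"
proof -
  note d = assms[unfolded local_derivation_def]
  show "0 \<le> R" "{} \<notin> F S" using d by blast+
  show "F (translate x S) = translate x (F S)" using d by blast
  show "coincide_on (cball x r) (F S) (F S')" if "coincide_on (cball x (r + R)) S S'"
    using d that by blast
qed

lemma tilings_eqI:
  fixes S S' :: "'a::euclidean_space set set"
  assumes "\<And>r. coincide_on (cball 0 r) S S'" "{} \<notin> S" "{} \<notin> S'"
  shows "S = S'"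
proof
  show "S \<subseteq> S'" by (rule subset_of_coincide_on_balls[OF assms(1,2)])
  show "S' \<subseteq> S" by (rule subset_of_coincide_on_balls[OF coincide_on_sym[OF assms(1)] assms(3)])
qed

text \<open>That \<open>F S\<close> is a tiling has to be proved: each bounded part of it agrees
  with a translate of \<open>F T\<close>, so \<open>tilings_closed\<close> applies.\<close>

lemma local_derivation_hull:
  assumes X: "prototile_set X" and T: "T \<in> tilings X"
    and X': "prototile_set X'" and T': "F T \<in> tilings X'"
    and F: "local_derivation F R" and S: "S \<in> tiling_hull X T"
  shows "F S \<in> tiling_hull X' (F T)"
proof -
  have loc: "\<exists>x. coincide_on (cball 0 r) (F S) (translate x (F T))" for r
  proof -
    obtain x where "coincide_on (cball 0 (r + R)) S (translate x T)"
      using S unfolding tiling_hull_eq[OF X T] by blast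
    then show ?thesis using local_derivationD(3,4)[OF F] by metis
  qed
  have "F S \<in> tilings X'"
    using tilings_closed[OF X' local_derivationD(2)[OF F]] loc translate_in_tilings[OF T'] by metis
  then show ?thesis unfolding tiling_hull_eq[OF X' T'] using loc by blast
qed

lemma local_derivation_uniformly_continuous:
  assumes F: "local_derivation F R" and e: "0 < e"
  obtains \<delta> where "0 < \<delta>" "\<And>S S'. tiling_dist S S' < \<delta> \<Longrightarrow> tiling_dist (F S) (F S') < e"
proof
  define d where "d = min (e / 2) (1 / 2)"
  have d: "0 < d" "d < 1" "d < e" using e by (auto simp: d_def)
  \<comment> \<open>Coincidence up to \<open>1 / \<delta>\<close> leaves, after the loss of
    \<open>R\<close>, coincidence up to \<open>1 / d\<close>; also \<open>\<delta> \<le> d\<close>,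
    so the shifts stay admissible.\<close>
  define \<delta> where "\<delta> = 1 / (1 / d + R)"
  have R: "0 \<le> R" by (rule local_derivationD(1)[OF F])
  have pos: "0 < 1 / d + R" using d R by (simp add: add_pos_nonneg)
  then show "0 < \<delta>" by (simp add: \<delta>_def)
  have "1 \<le> d * (1 / d + R)" using d R by (simp add: distrib_left)
  then have "\<delta> \<le> d" unfolding \<delta>_def using pos by (simp add: pos_divide_le_eq)
  fix S S' :: "'a set set" assume "tiling_dist S S' < \<delta>"
  then obtain h where h: "h \<in> close_eps S S'" "h < \<delta>"
    using tiling_dist_lt \<open>\<delta> \<le> d\<close> d(2) by (metis less_le_trans less_le)
  then obtain x x' where x: "norm x \<le> h" "norm x' \<le> h" "0 < h"
    and c: "coincide_on (cball 0 (1 / h)) (translate x S) (translate x' S')"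
    by (auto simp: close_eps_def)
  have "1 / \<delta> < 1 / h" using x h by (simp add: frac_less2)
  then have "1 / d + R \<le> 1 / h" by (simp add: \<delta>_def)
  then have "coincide_on (cball 0 (1 / d + R)) (translate x S) (translate x' S')"
    by (intro coincide_on_mono[OF c]) auto
  then have "coincide_on (cball 0 (1 / d)) (translate x (F S)) (translate x' (F S'))"
    using local_derivationD(3,4)[OF F] by metis
  moreover have "norm x \<le> d" "norm x' \<le> d" using x h \<open>\<delta> \<le> d\<close> by auto
  ultimately have "d \<in> close_eps (F S) (F S')" using d unfolding close_eps_def by blast
  then show "tiling_dist (F S) (F S') < e" using tiling_dist_le d(3) by fastforce
qed

lemma local_derivation_continuous:
  assumes X: "prototile_set X" and T: "T \<in> tilings X"
    and X': "prototile_set X'" and T': "F T \<in> tilings X'" and F: "local_derivation F R"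
  shows "continuous_map (subtopology (tiling_top X) (tiling_hull X T))
    (subtopology (tiling_top X') (tiling_hull X' (F T))) F"
proof -
  have sub: "Submetric (tilings X) tiling_dist (tiling_hull X T)"
    if "prototile_set X" "T \<in> tilings X" for X T :: "'a set set"
    unfolding Submetric_def Submetric_axioms_def
    using Metric_space_tilings tiling_hull_eq that by blast
  interpret S1: Submetric "tilings X" tiling_dist "tiling_hull X T" by (rule sub[OF X T])
  interpret S2: Submetric "tilings X'" tiling_dist "tiling_hull X' (F T)" by (rule sub[OF X' T'])
  have "continuous_map S1.sub.mtopology S2.sub.mtopology F"
    unfolding S1.sub.metric_continuous_map[OF S2.sub.Metric_space_axioms]
    using local_derivation_hull[OF X T X' T' F] local_derivation_uniformly_continuous[OF F]
    by (metis image_subsetI)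
  then show ?thesis unfolding S1.mtopology_submetric S2.mtopology_submetric tiling_top_def .
qed

text \<open>The identity is known at \<open>T\<close> only. By equivariance it holds on the orbit,
  and \<open>S\<close> agrees with orbit elements on balls large enough for both ranges.\<close>

lemma local_derivation_inverse:
  assumes X: "prototile_set X" and T: "T \<in> tilings X"
    and F: "local_derivation F R" and G: "local_derivation G R'" and GF: "G (F T) = T"
    and S: "S \<in> tiling_hull X T"
  shows "G (F S) = S"
proof (rule tilings_eqI)
  show "{} \<notin> G (F S)" by (rule local_derivationD(2)[OF G])
  show "{} \<notin> S" using S empty_notin_tiling[OF X] unfolding tiling_hull_eq[OF X T] by blast
  fix r
  obtain x where x: "coincide_on (cball 0 (r + R' + R)) S (translate x T)"
    using S unfolding tiling_hull_eq[OF X T] by blast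
  then have "coincide_on (cball 0 r) (G (F S)) (G (F (translate x T)))"
    using local_derivationD(4)[OF F] local_derivationD(4)[OF G] by blast
  then have "coincide_on (cball 0 r) (G (F S)) (translate x T)"
    using local_derivationD(3)[OF F] local_derivationD(3)[OF G] GF by metis
  moreover have "coincide_on (cball 0 r) S (translate x T)"
    using local_derivationD(1)[OF F] local_derivationD(1)[OF G]
    by (intro coincide_on_mono[OF x]) auto
  ultimately show "coincide_on (cball 0 r) (G (F S)) S" by (simp add: coincide_on_def)
qed

lemma hull_equivalent_of_derivations:
  assumes X: "prototile_set X" and T: "T \<in> tilings X"
    and X': "prototile_set X'" and T': "F T \<in> tilings X'"
    and F: "local_derivation F R" and G: "local_derivation G R'" and GF: "G (F T) = T"
  shows "hull_equivalent X T X' (F T)"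
proof -
  have top: "topspace (subtopology (tiling_top X) (tiling_hull X T)) = tiling_hull X T"
    if "prototile_set X" "T \<in> tilings X" for X T :: "'a set set"
  proof -
    interpret Metric_space "tilings X" tiling_dist by (rule Metric_space_tilings[OF that(1)])
    show ?thesis using tiling_hull_eq[OF that] by (auto simp: tiling_top_def)
  qed
  \<comment> \<open>With the identity in the other direction, the roles of \<open>F\<close> and
    \<open>G\<close> can be exchanged in the lemmas on continuity and inverses.\<close>
  have GT: "G (F T) \<in> tilings X" "F (G (F T)) = F T" using GF T by auto
  have "homeomorphic_maps (subtopology (tiling_top X) (tiling_hull X T))
      (subtopology (tiling_top X') (tiling_hull X' (F T))) F G"
    unfolding homeomorphic_maps_def top[OF X T] top[OF X' T']
    using local_derivation_continuous[where F = F, OF X T X' T' F]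
      local_derivation_continuous[where F = G, OF X' T' X GT(1) G]
      local_derivation_inverse[OF X T F G GF] local_derivation_inverse[OF X' T' G F GT(2)]
    by (simp add: GF)
  then show ?thesis
    unfolding hull_equivalent_def homeomorphic_map_maps using local_derivationD(3)[OF F] by blast
qed

section \<open>Inheritance of aperiodicity, repetitivity and the finite pattern condition\<close>

lemma equiv_translation_rel:
  "equiv UNIV (translation_rel :: ('a::euclidean_space set set \<times> 'a set set) set)" (is "equiv _ ?r")
proof (rule equivI)
  show "refl ?r"
  proof (rule reflI)
    fix P :: "'a set set"
    have "P = translate 0 P" by simp
    then show "(P, P) \<in> translation_rel" unfolding translation_rel_def by blast
  qed
  show "sym ?r"
  proof (rule symI)
    fix P Q :: "'a set set" assume "(P, Q) \<in> translation_rel"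
    then obtain x where "Q = translate x P" by (auto simp: translation_rel_def)
    then have "P = translate (- x) Q" by (simp add: translate_translate)
    then show "(Q, P) \<in> translation_rel" unfolding translation_rel_def by blast
  qed
  show "trans ?r"
  proof (rule transI)
    fix P Q Z :: "'a set set" assume "(P, Q) \<in> translation_rel" "(Q, Z) \<in> translation_rel"
    then obtain x y where "Q = translate x P" "Z = translate y Q"
      by (auto simp: translation_rel_def)
    then have "Z = translate (y + x) P" by (simp add: translate_translate)
    then show "(P, Z) \<in> translation_rel" unfolding translation_rel_def by blast
  qed
qed auto

text \<open>Quotient classes are replaced by finitely many models. A model in \<open>Q\<close> may
  be any collection of sets, not necessarily a patch of \<open>T\<close>.\<close>

lemma finite_pattern_condition_iff:
  "finite_pattern_condition T \<longleftrightarrow>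
    (\<forall>s>0. \<exists>Q. finite Q \<and> (\<forall>P. patch T P \<and> diameter (\<Union>P) < s \<longrightarrow> (\<exists>q\<in>Q. \<exists>x. P = translate x q)))"
  unfolding finite_pattern_condition_def
proof (intro iff_allI imp_cong refl iffI)
  fix s :: real
  let ?A = "{P. patch T P \<and> diameter (\<Union>P) < s}"
  {
    assume fin: "finite (?A // translation_rel)"
    have "P \<in> translation_rel `` {P}" for P :: "'a set set"
      using equiv_class_self[OF equiv_translation_rel] by blast
    then have "\<exists>P. P \<in> c" if "c \<in> ?A // translation_rel" for c
      using that by (auto elim!: quotientE)
    then obtain f where f: "\<And>c. c \<in> ?A // translation_rel \<Longrightarrow> f c \<in> c" by metis
    have "\<exists>q\<in>f ` (?A // translation_rel). \<exists>x. P = translate x q" if P: "P \<in> ?A" for P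
    proof -
      have c: "translation_rel `` {P} \<in> ?A // translation_rel" using P by (rule quotientI)
      then have "(P, f (translation_rel `` {P})) \<in> translation_rel" using f[OF c] by blast
      then have "(f (translation_rel `` {P}), P) \<in> translation_rel"
        using equiv_translation_rel by (meson equivE symD)
      then show ?thesis using c unfolding translation_rel_def by blast
    qed
    then show "\<exists>Q. finite Q \<and> (\<forall>P. patch T P \<and> diameter (\<Union>P) < s \<longrightarrow> (\<exists>q\<in>Q. \<exists>x. P = translate x q))"
      using fin by (intro exI[of _ "f ` (?A // translation_rel)"]) auto
  next
    assume "\<exists>Q. finite Q \<and> (\<forall>P. patch T P \<and> diameter (\<Union>P) < s \<longrightarrow> (\<exists>q\<in>Q. \<exists>x. P = translate x q))"
    then obtain Q where Q: "finite Q" "\<And>P. P \<in> ?A \<Longrightarrow> \<exists>q\<in>Q. \<exists>x. P = translate x q" by blast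
    have "?A // translation_rel \<subseteq> (\<lambda>q. translation_rel `` {q}) ` Q"
    proof
      fix c assume "c \<in> ?A // translation_rel"
      then obtain P where P: "P \<in> ?A" "c = translation_rel `` {P}" by (rule quotientE)
      obtain q x where q: "q \<in> Q" "P = translate x q" using Q(2)[OF P(1)] by blast
      then have "(q, P) \<in> translation_rel" by (auto simp: translation_rel_def)
      then have "translation_rel `` {q} = translation_rel `` {P}"
        by (rule equiv_class_eq[OF equiv_translation_rel])
      then show "c \<in> (\<lambda>q. translation_rel `` {q}) ` Q" using P q by blast
    qed
    then show "finite (?A // translation_rel)" using Q(1) finite_surj by blast
  }
qed

lemma bounded_patch:
  assumes "prototile_set X" "T \<in> tilings X" "patch T P"
  shows "bounded (\<Union>P)"
  using assms tile_prototile[OF assms(1,2)]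
  by (auto simp: patch_def prototile_def intro!: bounded_Union compact_imp_bounded)

lemma aperiodic_derivation:
  assumes F: "local_derivation F R" and G: "local_derivation G R'" and GF: "G (F T) = T"
    and ap: "aperiodic T"
  shows "aperiodic (F T)"
  unfolding aperiodic_def
proof (intro allI impI)
  fix x assume "translate x (F T) = F T"
  then have "translate x T = T" using local_derivationD(3)[OF G] GF by metis
  then show "x = 0" using ap by (simp add: aperiodic_def)
qed

text \<open>A patch of \<open>F T\<close> near the origin is determined by a patch of
  \<open>T\<close> around it, so each reappearance of the latter brings a copy of the
  former.\<close>

lemma repetitive_derivation:
  fixes X :: "'a::euclidean_space set set"
  assumes X: "prototile_set X" and T: "T \<in> tilings X"
    and X': "prototile_set X'" and T': "F T \<in> tilings X'"
    and F: "local_derivation F R" and rep: "repetitive T"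
  shows "repetitive (F T)"
  unfolding repetitive_def
proof (intro allI impI)
  fix P' assume P': "patch (F T) P'"
  obtain r where r: "0 < r" "\<And>u. u \<in> \<Union>P' \<Longrightarrow> norm u \<le> r"
    using bounded_patch[OF X' T' P'] unfolding bounded_pos by blast
  have R: "0 \<le> R" by (rule local_derivationD(1)[OF F])
  \<comment> \<open>\<open>R\<close> is the range of \<open>F\<close>; the additional 1 is the
    margin demanded by \<open>coincide_on_of_subset\<close>.\<close>
  define P where "P = {t \<in> T. t \<inter> cball 0 (r + R + 1) \<noteq> {}}"
  have "patch T P" using finite_tiles_meeting[OF X T] by (simp add: patch_def P_def)
  then obtain s where s: "0 < s" "\<And>x. \<exists>y. translate y P \<subseteq> T \<and> \<Union>(translate y P) \<subseteq> cball x s"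
    using rep unfolding repetitive_def by blast
  have "\<exists>y. translate y P' \<subseteq> F T \<and> \<Union>(translate y P') \<subseteq> cball x (s + r)" for x
  proof -
    obtain y where y: "translate y P \<subseteq> T" "\<Union>(translate y P) \<subseteq> cball x s" using s(2) by blast
    have "translate (- y) (translate y P) \<subseteq> translate (- y) T" by (rule translate_mono[OF y(1)])
    then have "P \<subseteq> translate (- y) T" by (simp add: translate_translate)
    then have "coincide_on (cball 0 (r + R)) T (translate (- y) T)"
      using coincide_on_of_subset[OF X T translate_in_tilings[OF T]] unfolding P_def by blast
    then have c: "coincide_on (cball 0 r) (F T) (translate (- y) (F T))"
      using local_derivationD(3,4)[OF F] by metis
    have "P' \<subseteq> translate (- y) (F T)"
    proof
      fix t assume t: "t \<in> P'"
      then have tT: "t \<in> F T" using P' by (auto simp: patch_def)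
      then have "t \<noteq> {}" using local_derivationD(2)[OF F] by metis
      then obtain u where "u \<in> t" by blast
      then have "u \<in> t \<inter> cball 0 r" using r t by auto
      then show "t \<in> translate (- y) (F T)" using c tT unfolding coincide_on_def by blast
    qed
    then have "translate y P' \<subseteq> translate y (translate (- y) (F T))" by (rule translate_mono)
    then have 1: "translate y P' \<subseteq> F T" by (simp add: translate_translate)
    \<comment> \<open>The origin lies in the support of \<open>P\<close>, so the location of the
      copy of \<open>P\<close> bounds the displacement \<open>y\<close>, and with it the copy of
      \<open>P'\<close>.\<close>
    have "0 \<in> \<Union>T" using T by (simp add: tilings_def)
    then obtain t where t: "t \<in> T" "0 \<in> t" by blast
    have "0 \<in> t \<inter> cball 0 (r + R + 1)" using t r R by simp
    then have "0 \<in> \<Union>P" using t unfolding P_def by blast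
    then have "y + 0 \<in> \<Union>(translate y P)" unfolding Union_translate by blast
    then have y0: "dist x y \<le> s" using y(2) by auto
    have "\<Union>(translate y P') \<subseteq> cball x (s + r)"
    proof
      fix v assume "v \<in> \<Union>(translate y P')"
      then obtain u where u: "u \<in> \<Union>P'" "v = y + u" unfolding Union_translate by blast
      have "dist y v \<le> r" using r(2)[OF u(1)] by (simp add: u(2) dist_norm)
      then show "v \<in> cball x (s + r)" using y0 dist_triangle[of x v y] by simp
    qed
    then show ?thesis using 1 by blast
  qed
  moreover have "0 < s + r" using s r by simp
  ultimately show "\<exists>s>0. \<forall>x. \<exists>y. translate y P' \<subseteq> F T \<and> \<Union>(translate y P') \<subseteq> cball x s"
    by blast
qed

text \<open>A patch of diameter below \<open>s\<close> lies in a ball around some \<open>u\<close>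
  and depends only on \<open>P u\<close>. As the \<open>P u\<close> are finite in number up to
  translation, every such patch can be moved into one of finitely many finite sets
  \<open>W q\<close>.\<close>

lemma finite_pattern_condition_derivation:
  fixes X :: "'a::euclidean_space set set"
  assumes X: "prototile_set X" and T: "T \<in> tilings X"
    and X': "prototile_set X'" and T': "F T \<in> tilings X'"
    and F: "local_derivation F R" and fpc: "finite_pattern_condition T"
  shows "finite_pattern_condition (F T)"
  unfolding finite_pattern_condition_iff
proof (intro allI impI)
  fix s :: real assume s: "0 < s"
  have R: "0 \<le> R" by (rule local_derivationD(1)[OF F])
  obtain D where D: "0 < D" "\<And>t u v. t \<in> T \<Longrightarrow> u \<in> t \<Longrightarrow> v \<in> t \<Longrightarrow> dist u v \<le> D"
    using tiles_uniform[OF X] T by metis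
  define P where "P u = {t \<in> T. t \<inter> cball u (s + R + 1) \<noteq> {}}" for u
  \<comment> \<open>The last summand \<open>D\<close> bounds how far a tile that meets the ball can
    stick out of it.\<close>
  define m where "m = s + R + 1 + D"
  have m: "0 < m" using s R D by (simp add: m_def)
  have near: "dist u v \<le> m" if v: "v \<in> \<Union>(P u)" for u v
  proof -
    obtain t w where t: "t \<in> T" "v \<in> t" "w \<in> t" "dist u w \<le> s + R + 1"
      using v unfolding P_def by auto
    then show ?thesis using D(2)[OF t(1,3,2)] dist_triangle[of u v w] by (simp add: m_def)
  qed
  have self: "u \<in> \<Union>(P u)" for u
  proof -
    have "u \<in> \<Union>T" using T by (simp add: tilings_def)
    then obtain t where t: "t \<in> T" "u \<in> t" by blast
    then have "u \<in> t \<inter> cball u (s + R + 1)" using s R by simp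
    then show ?thesis using t unfolding P_def by blast
  qed
  have patch: "patch T (P u)" for u
    using finite_tiles_meeting[OF X T] by (simp add: patch_def P_def)
  have diam: "diameter (\<Union>(P u)) < 3 * m" for u
  proof -
    have "diameter (\<Union>(P u)) \<le> 2 * m"
    proof (rule diameter_le)
      show "\<Union>(P u) \<noteq> {} \<or> 0 \<le> 2 * m" using m by simp
      fix v w assume "v \<in> \<Union>(P u)" "w \<in> \<Union>(P u)"
      then show "norm (v - w) \<le> 2 * m"
        using near[of v u] near[of w u] dist_triangle[of v w u] by (simp add: dist_norm norm_minus_commute)
    qed
    then show ?thesis using m by simp
  qed
  have "0 < 3 * m" using m by simp
  then obtain Q where Q: "finite Q" "\<And>u. \<exists>q\<in>Q. \<exists>x. P u = translate x q"
    using fpc patch diam unfolding finite_pattern_condition_iff by meson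
  \<comment> \<open>A model \<open>q\<close> does not remember a centre; \<open>c q\<close> is some
    point of space whose surroundings in \<open>T\<close> have the pattern \<open>q\<close>.\<close>
  define c where "c q = (SOME u. \<exists>x. P u = translate x q)" for q
  have c: "\<exists>x. P (c q) = translate x q" if "P u = translate x q" for u x q
    unfolding c_def using someI_ex[of "\<lambda>u. \<exists>x. P u = translate x q"] that by blast
  \<comment> \<open>The radius is \<open>s + m\<close> and not \<open>s\<close>: a translation
    taking \<open>P (c q)\<close> to \<open>P u\<close> need not take \<open>c q\<close> to
    \<open>u\<close>, but it takes \<open>c q\<close> into the support of \<open>P u\<close>, hence
    to within \<open>m\<close> of \<open>u\<close>.\<close>
  define W where "W q = {t \<in> F T. t \<inter> cball (c q) (s + m) \<noteq> {}}" for q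
  have "\<exists>q\<in>\<Union>(Pow ` W ` Q). \<exists>x. P' = translate x q"
    if P': "patch (F T) P'" "diameter (\<Union>P') < s" for P'
  proof -
    have bd: "bounded (\<Union>P')" by (rule bounded_patch[OF X' T' P'(1)])
    obtain u where u: "\<Union>P' \<subseteq> cball u s"
    proof (cases "\<Union>P' = {}")
      case False
      then obtain u where u: "u \<in> \<Union>P'" by blast
      have "dist u v \<le> s" if "v \<in> \<Union>P'" for v
        using diameter_bounded_bound[OF bd u that] P'(2) by simp
      then show ?thesis using that by (meson mem_cball subsetI)
    qed (use that in blast)
    obtain q x where q: "q \<in> Q" "P u = translate x q" using Q(2) by blast
    obtain y where y: "P (c q) = translate y q" using c[OF q(2)] by blast
    define z where "z = x - y"
    have Pz: "P u = translate z (P (c q))" by (simp add: q y z_def translate_translate)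
    also have "\<dots> \<subseteq> translate z T" by (rule translate_mono) (auto simp: P_def)
    finally have "coincide_on (cball u (s + R)) T (translate z T)"
      using coincide_on_of_subset[OF X T translate_in_tilings[OF T]] unfolding P_def by blast
    then have co: "coincide_on (cball u s) (F T) (translate z (F T))"
      using local_derivationD(3,4)[OF F] by metis
    have "z + c q \<in> \<Union>(P u)" using self[of "c q"] unfolding Pz Union_translate by blast
    then have dz: "dist u (z + c q) \<le> m" by (rule near)
    have "translate (- z) P' \<subseteq> W q"
    proof
      fix t' assume "t' \<in> translate (- z) P'"
      then obtain t where t: "t \<in> P'" "t' = (+) (- z) ` t" by (auto simp: translate_def)
      have tT: "t \<in> F T" using t P' by (auto simp: patch_def)
      then have "t \<noteq> {}" using local_derivationD(2)[OF F] by metis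
      then obtain v where v: "v \<in> t" by blast
      then have "v \<in> t \<inter> cball u s" using u t by blast
      then have "t \<in> translate z (F T)" using co tT unfolding coincide_on_def by blast
      then have "t' \<in> F T" using t(2) mem_translate_iff by metis
      moreover have "- z + v \<in> t'" using v t(2) by blast
      moreover have "- z + v \<in> cball (c q) (s + m)"
      proof -
        have "dist u v \<le> s" using \<open>v \<in> t \<inter> cball u s\<close> by simp
        then have "dist (z + c q) v \<le> s + m"
          using dz dist_triangle[of "z + c q" v u] by (simp add: dist_commute)
        then show ?thesis by (simp add: dist_norm algebra_simps)
      qed
      ultimately show "t' \<in> W q" unfolding W_def by blast
    qed
    moreover have "P' = translate z (translate (- z) P')" by (simp add: translate_translate)
    ultimately show ?thesis using q(1) by blast
  qed
  moreover have "finite (\<Union>(Pow ` W ` Q))"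
    using Q(1) finite_tiles_meeting[OF X' T'] by (auto simp: W_def)
  ultimately show "\<exists>Q. finite Q \<and>
      (\<forall>P. patch (F T) P \<and> diameter (\<Union>P) < s \<longrightarrow> (\<exists>q\<in>Q. \<exists>x. P = translate x q))"
    by blast
qed

lemma perfect_derivation:
  fixes X :: "'a::euclidean_space set set"
  assumes X: "prototile_set X" "T \<in> tilings X" and X': "prototile_set X'" "F T \<in> tilings X'"
    and F: "local_derivation F R" and G: "local_derivation G R'" "G (F T) = T"
    and T: "perfect T"
  shows "perfect (F T)"
proof -
  have "aperiodic T" "repetitive T" "finite_pattern_condition T"
    using T by (simp_all add: perfect_def)
  then show ?thesis
    unfolding perfect_def
    using aperiodic_derivation[OF F G] repetitive_derivation[where F = F, OF X X' F]
      finite_pattern_condition_derivation[where F = F, OF X X' F]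
    by simp
qed

section \<open>Boxes\<close>

text \<open>A reference point that commutes with translation; it need not belong to the set.\<close>

definition corner :: "(real ^ 'd) set \<Rightarrow> real ^ 'd" where
  "corner t = (\<chi> i. INF x\<in>t. x $ i)"

definition hbox :: "real ^ 'd \<Rightarrow> real ^ 'd \<Rightarrow> (real ^ 'd) set" where
  "hbox l h = {w. \<forall>i. l $ i \<le> w $ i \<and> w $ i < h $ i}"

lemma bdd_below_component:
  fixes t :: "(real ^ 'd) set"
  assumes "bounded t"
  shows "bdd_below ((\<lambda>x. x $ i) ` t)"
  by (rule bounded_imp_bdd_below[OF bounded_component_cart[OF assms]])

lemma corner_le:
  fixes t :: "(real ^ 'd) set"
  assumes "bounded t" "u \<in> t"
  shows "corner t $ i \<le> u $ i"
  unfolding corner_def vec_lambda_beta by (rule cINF_lower[OF bdd_below_component[OF assms(1)] assms(2)])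

lemma corner_translation:
  fixes t :: "(real ^ 'd) set"
  assumes "bounded t" "t \<noteq> {}"
  shows "corner ((+) x ` t) = x + corner t"
proof -
  have "Inf ((\<lambda>y. y $ i) ` (+) x ` t) = x $ i + corner t $ i" for i
  proof (rule cInf_eq_non_empty)
    show "x $ i + corner t $ i \<le> y" if "y \<in> (\<lambda>y. y $ i) ` (+) x ` t" for y
      using that corner_le[OF assms(1)] by auto
    fix y assume y: "\<And>w. w \<in> (\<lambda>y. y $ i) ` (+) x ` t \<Longrightarrow> y \<le> w"
    have "y - x $ i \<le> u $ i" if "u \<in> t" for u
    proof -
      have "y \<le> (x + u) $ i" using that by (intro y) blast
      then show ?thesis by simp
    qed
    then have "y - x $ i \<le> corner t $ i"
      unfolding corner_def using assms(2) by (simp add: cINF_greatest)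
    then show "y \<le> x $ i + corner t $ i" by simp
  qed (use assms(2) in simp)
  then show ?thesis by (simp add: vec_eq_iff corner_def)
qed

text \<open>Attainment lets a strict bound on coordinate differences within a tile become a strict
  bound relative to its corner.\<close>

lemma corner_attained:
  fixes t :: "(real ^ 'd) set"
  assumes "compact t" "t \<noteq> {}"
  obtains v where "v \<in> t" "v $ i = corner t $ i"
proof -
  have "compact ((\<lambda>x. x $ i) ` t)"
    by (intro compact_continuous_image assms continuous_intros)
  then have "Inf ((\<lambda>x. x $ i) ` t) \<in> (\<lambda>x. x $ i) ` t"
    using assms by (intro closed_contains_Inf compact_imp_closed bdd_below_component compact_imp_bounded) auto
  then show ?thesis using that by (auto simp: corner_def)
qed

lemma corner_eqI:
  assumes "l \<in> t" "\<And>w i. w \<in> t \<Longrightarrow> l $ i \<le> w $ i"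
  shows "corner t = l"
proof -
  have "Inf ((\<lambda>x. x $ i) ` t) = l $ i" for i
    using assms by (intro cInf_eq_minimum) auto
  then show ?thesis by (simp add: vec_eq_iff corner_def)
qed

lemma corner_hbox:
  fixes l h :: "real ^ 'd"
  shows "\<forall>i. l $ i < h $ i \<Longrightarrow> corner (hbox l h) = l"
  by (rule corner_eqI) (simp_all add: hbox_def)

lemma corner_cbox:
  fixes l h :: "real ^ 'd"
  shows "\<forall>i. l $ i < h $ i \<Longrightarrow> corner (cbox l h) = l"
  by (rule corner_eqI) (simp_all add: mem_box_cart less_imp_le)

lemma box_nonempty:
  fixes l h :: "real ^ 'd"
  assumes "\<forall>i. l $ i < h $ i"
  shows "box l h \<noteq> {}"
  using assms by (simp add: interval_ne_empty_cart)

lemma hbox_subset_cbox: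
  fixes l h :: "real ^ 'd"
  shows "hbox l h \<subseteq> cbox l h"
  by (simp add: subset_iff hbox_def mem_box_cart less_imp_le)

lemma box_subset_hbox:
  fixes l h :: "real ^ 'd"
  shows "box l h \<subseteq> hbox l h"
  by (simp add: subset_iff hbox_def mem_box_cart less_imp_le)

lemma closure_hbox:
  assumes "\<forall>i. l $ i < h $ i"
  shows "closure (hbox l h) = cbox l h"
proof
  show "closure (hbox l h) \<subseteq> cbox l h" by (rule closure_minimal[OF hbox_subset_cbox closed_cbox])
  show "cbox l h \<subseteq> closure (hbox l h)"
    using closure_mono[OF box_subset_hbox[of l h]] closure_box[OF box_nonempty[OF assms]] by simp
qed

lemma interior_cbox_subset_hbox:
  fixes l h :: "real ^ 'd"
  shows "interior (cbox l h) \<subseteq> hbox l h"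
  by (simp add: interior_cbox box_subset_hbox)

lemma hbox_translation: "(+) x ` hbox l h = hbox (x + l) (x + h)"
proof
  show "hbox (x + l) (x + h) \<subseteq> (+) x ` hbox l h"
  proof
    fix w assume "w \<in> hbox (x + l) (x + h)"
    then have "l $ i \<le> (w - x) $ i \<and> (w - x) $ i < h $ i" for i
      by (auto simp: hbox_def algebra_simps)
    then have "w - x \<in> hbox l h" by (simp add: hbox_def)
    then have "x + (w - x) \<in> (+) x ` hbox l h" by blast
    then show "w \<in> (+) x ` hbox l h" by simp
  qed
qed (auto simp: hbox_def)

lemma hbox_inject:
  assumes "\<forall>i. l $ i < h $ i" "\<forall>i. l' $ i < h' $ i" "hbox l h = hbox l' h'"
  shows "l = l' \<and> h = h'"
proof -
  have "cbox l h = cbox l' h'" using assms closure_hbox by metis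
  moreover have "cbox l h \<noteq> {}" using box_nonempty[OF assms(1)] box_subset_cbox by fastforce
  ultimately show ?thesis by (simp add: eq_cbox)
qed

lemma prototile_cbox:
  fixes l h :: "real ^ 'd"
  assumes "\<forall>i. l $ i < h $ i"
  shows "prototile (cbox l h)"
  using closure_box[OF box_nonempty[OF assms]] box_nonempty[OF assms] box_subset_cbox[of l h]
  by (auto simp: prototile_def interior_cbox convex_connected)

lemma rectangle_cbox:
  fixes l h :: "real ^ 'd"
  assumes "\<forall>i. l $ i < h $ i"
  shows "rectangle (cbox l h)"
  unfolding rectangle_def
proof (intro exI conjI)
  show "pairwise orthogonal (Basis :: (real ^ 'd) set)"
    by (simp add: pairwise_def orthogonal_def inner_Basis)
  show "\<forall>b\<in>(Basis :: (real ^ 'd) set). norm b = 1" by simp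
  show "span (Basis :: (real ^ 'd) set) = UNIV" by simp
  show "\<forall>b\<in>Basis. l \<bullet> b < h \<bullet> b"
    using box_nonempty[OF assms] by (simp add: box_ne_empty)
  show "cbox l h = {\<Sum>b\<in>Basis. c b *\<^sub>R b |c. \<forall>b\<in>Basis. c b \<in> {l \<bullet> b..h \<bullet> b}}"
  proof (intro equalityI subsetI)
    fix w assume "w \<in> cbox l h"
    then have "\<forall>b\<in>Basis. w \<bullet> b \<in> {l \<bullet> b..h \<bullet> b}" by (simp add: mem_box)
    moreover have "w = (\<Sum>b\<in>Basis. (w \<bullet> b) *\<^sub>R b)" by (simp add: euclidean_representation)
    ultimately show "w \<in> {\<Sum>b\<in>Basis. c b *\<^sub>R b |c. \<forall>b\<in>Basis. c b \<in> {l \<bullet> b..h \<bullet> b}}"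
      by (intro CollectI exI[of _ "\<lambda>b. w \<bullet> b"]) simp
  next
    fix w assume "w \<in> {\<Sum>b\<in>Basis. c b *\<^sub>R b |c. \<forall>b\<in>Basis. c b \<in> {l \<bullet> b..h \<bullet> b}}"
    then show "w \<in> cbox l h" by (auto simp: mem_box inner_sum_left_Basis)
  qed
qed

lemma hbox_less: "z \<in> hbox l h \<Longrightarrow> l $ i < h $ i"
  using le_less_trans[of "l $ i" "z $ i" "h $ i"] by (simp add: hbox_def)

definition upd :: "real ^ 'd \<Rightarrow> 'd \<Rightarrow> real \<Rightarrow> real ^ 'd" where
  "upd v k a = (\<chi> i. if i = k then a else v $ i)"

lemma upd_nth: "upd v k a $ i = (if i = k then a else v $ i)"
  by (simp add: upd_def)

lemma hbox_cut:
  assumes "l $ k < a" "a < h $ k"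
  shows "hbox l h \<inter> {w. w $ k < a} = hbox l (upd h k a)"
    and "hbox l h \<inter> {w. a \<le> w $ k} = hbox (upd l k a) h"
proof -
  have "w \<in> hbox l h \<and> w $ k < a \<longleftrightarrow> w \<in> hbox l (upd h k a)" for w
  proof
    assume "w \<in> hbox l h \<and> w $ k < a"
    then show "w \<in> hbox l (upd h k a)" by (simp add: hbox_def upd_nth)
  next
    assume w: "w \<in> hbox l (upd h k a)"
    have "w $ i < upd h k a $ i" "l $ i \<le> w $ i" for i using w unfolding hbox_def by blast+
    moreover have "upd h k a $ i \<le> h $ i" for i using assms by (simp add: upd_nth)
    ultimately have "l $ i \<le> w $ i \<and> w $ i < h $ i" for i by (meson less_le_trans)
    then have "w \<in> hbox l h" unfolding hbox_def by blast
    moreover have "w $ k < upd h k a $ k" using w unfolding hbox_def by blast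
    ultimately show "w \<in> hbox l h \<and> w $ k < a" by (simp add: upd_nth)
  qed
  then show "hbox l h \<inter> {w. w $ k < a} = hbox l (upd h k a)" by (simp add: set_eq_iff)
  have "w \<in> hbox l h \<and> a \<le> w $ k \<longleftrightarrow> w \<in> hbox (upd l k a) h" for w
  proof
    assume "w \<in> hbox l h \<and> a \<le> w $ k"
    then show "w \<in> hbox (upd l k a) h" by (simp add: hbox_def upd_nth)
  next
    assume w: "w \<in> hbox (upd l k a) h"
    have "upd l k a $ i \<le> w $ i" "w $ i < h $ i" for i using w unfolding hbox_def by blast+
    moreover have "l $ i \<le> upd l k a $ i" for i using assms by (simp add: upd_nth)
    ultimately have "l $ i \<le> w $ i \<and> w $ i < h $ i" for i by (meson order_trans)
    then have "w \<in> hbox l h" unfolding hbox_def by blast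
    moreover have "upd l k a $ k \<le> w $ k" using w unfolding hbox_def by blast
    ultimately show "w \<in> hbox l h \<and> a \<le> w $ k" by (simp add: upd_nth)
  qed
  then show "hbox l h \<inter> {w. a \<le> w $ k} = hbox (upd l k a) h" by (simp add: set_eq_iff)
qed

text \<open>The class of \<open>z\<close> under lying on the same side of every hyperplane
  \<open>w $ i = c\<close> with \<open>c\<close> in \<open>K i\<close>. Using \<open>\<le>\<close>
  assigns the hyperplane itself to its upper side, in accordance with \<open>hbox\<close>.\<close>

definition cutbox :: "('d \<Rightarrow> real set) \<Rightarrow> real ^ 'd \<Rightarrow> (real ^ 'd) set" where
  "cutbox K z = {w. \<forall>i. \<forall>c\<in>K i. c \<le> z $ i \<longleftrightarrow> c \<le> w $ i}"

lemma self_in_cutbox: "z \<in> cutbox K z"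
  by (simp add: cutbox_def)

lemma cutbox_eq:
  assumes "w \<in> cutbox K z"
  shows "cutbox K w = cutbox K z"
proof -
  have "c \<le> w $ i \<longleftrightarrow> c \<le> z $ i" if "c \<in> K i" for c i
    using assms that by (simp add: cutbox_def)
  then show ?thesis by (simp add: cutbox_def)
qed

lemma cutbox_translation:
  fixes K :: "'d::finite \<Rightarrow> real set"
  assumes "\<And>i. K' i = (+) (x $ i) ` K i"
  shows "cutbox K' (x + z) = (+) x ` cutbox K z"
proof
  show "cutbox K' (x + z) \<subseteq> (+) x ` cutbox K z"
  proof
    fix w assume w: "w \<in> cutbox K' (x + z)"
    have "w - x \<in> cutbox K z"
      unfolding cutbox_def
    proof (intro CollectI allI ballI)
      fix i c assume "c \<in> K i"
      then have "x $ i + c \<in> K' i" using assms by blast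
      then have "x $ i + c \<le> (x + z) $ i \<longleftrightarrow> x $ i + c \<le> w $ i" using w unfolding cutbox_def by blast
      then show "c \<le> z $ i \<longleftrightarrow> c \<le> (w - x) $ i" by (simp add: algebra_simps)
    qed
    then have "x + (w - x) \<in> (+) x ` cutbox K z" by blast
    then show "w \<in> (+) x ` cutbox K z" by simp
  qed
qed (auto simp: cutbox_def assms)

text \<open>Only the nearest cuts on the two sides of \<open>z\<close> matter: every other cut lies
  beyond them.\<close>

lemma cutbox_hbox:
  fixes K :: "'d::finite \<Rightarrow> real set"
  assumes fin: "\<And>i. finite (K i)" and lo: "\<And>i. \<exists>c\<in>K i. c \<le> z $ i" and hi: "\<And>i. \<exists>c\<in>K i. z $ i < c"
  obtains l h where "cutbox K z = hbox l h" "z \<in> hbox l h"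
proof
  define l h :: "real ^ 'd" where "l = (\<chi> i. Max {c \<in> K i. c \<le> z $ i})"
    and "h = (\<chi> i. Min {c \<in> K i. z $ i < c})"
  have l: "l $ i \<in> K i" "l $ i \<le> z $ i" for i
  proof -
    have "Max {c \<in> K i. c \<le> z $ i} \<in> {c \<in> K i. c \<le> z $ i}"
      using fin lo by (intro Max_in) auto
    then show "l $ i \<in> K i" "l $ i \<le> z $ i" by (auto simp: l_def)
  qed
  have h: "h $ i \<in> K i" "z $ i < h $ i" for i
  proof -
    have "Min {c \<in> K i. z $ i < c} \<in> {c \<in> K i. z $ i < c}"
      using fin hi by (intro Min_in) auto
    then show "h $ i \<in> K i" "z $ i < h $ i" by (auto simp: h_def)
  qed
  show "z \<in> hbox l h" using l h by (simp add: hbox_def)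
  have le: "c \<le> l $ i" if "c \<in> K i" "c \<le> z $ i" for c i
    using that fin by (simp add: l_def)
  have ge: "h $ i \<le> c" if "c \<in> K i" "\<not> c \<le> z $ i" for c i
    using that fin by (simp add: h_def)
  show "cutbox K z = hbox l h"
  proof (intro equalityI subsetI)
    fix w assume w: "w \<in> cutbox K z"
    then have "l $ i \<le> w $ i" "w $ i < h $ i" for i
      using l[of i] h[of i] unfolding cutbox_def by (auto simp flip: not_le)
    then show "w \<in> hbox l h" by (simp add: hbox_def)
  next
    fix w assume w: "w \<in> hbox l h"
    have "c \<le> z $ i \<longleftrightarrow> c \<le> w $ i" if "c \<in> K i" for c i
    proof
      show "c \<le> w $ i" if "c \<le> z $ i"
        using le[OF \<open>c \<in> K i\<close> that] w unfolding hbox_def by (auto intro: order_trans)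
      show "c \<le> z $ i" if "c \<le> w $ i"
      proof (rule ccontr)
        assume "\<not> c \<le> z $ i"
        then have "h $ i \<le> c" by (rule ge[OF \<open>c \<in> K i\<close>])
        moreover have "w $ i < h $ i" using w by (simp add: hbox_def)
        ultimately show False using that by simp
      qed
    qed
    then show "w \<in> cutbox K z" by (simp add: cutbox_def)
  qed
qed

text \<open>A class is determined by which cuts lie at or below its points, that is, by one subset
  of each finite \<open>K i\<close>.\<close>

lemma finite_range_cutbox:
  fixes K :: "'d::finite \<Rightarrow> real set"
  assumes "\<And>i. finite (K i)"
  shows "finite (range (cutbox K))"
proof -
  define f where "f s = {w :: real ^ 'd. \<forall>i. \<forall>c\<in>K i. c \<in> s i \<longleftrightarrow> c \<le> w $ i}" for s
  have "cutbox K z \<in> f ` PiE UNIV (\<lambda>i. Pow (K i))" for z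
  proof (rule image_eqI)
    show "cutbox K z = f (\<lambda>i. {c \<in> K i. c \<le> z $ i})" by (simp add: cutbox_def f_def)
  qed auto
  moreover have "finite (f ` PiE UNIV (\<lambda>i. Pow (K i)))"
    using assms by (intro finite_imageI finite_PiE) auto
  ultimately show ?thesis by (meson finite_subset image_subsetI)
qed

section \<open>Cutting space into bricks\<close>

text \<open>By \<open>small\<close>, a tile is narrower than \<open>L\<close> in every coordinate
  and hence contained in the half-open cube of side \<open>L\<close> at its corner.\<close>

locale brick_cutting =
  fixes X :: "(real ^ 'd) set set" and L :: real
  assumes X: "prototile_set X"
    and small: "\<And>p u v i. p \<in> X \<Longrightarrow> u \<in> p \<Longrightarrow> v \<in> p \<Longrightarrow> u $ i - v $ i < L"
    and L_pos: "0 < L"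
begin

text \<open>Acts as a filter: the constructions below accept arbitrary collections, whose members
  may be empty or unbounded, and \<open>corner\<close> behaves well only on genuine tiles.\<close>

definition is_tile :: "(real ^ 'd) set \<Rightarrow> bool" where
  "is_tile t \<longleftrightarrow> (\<exists>p\<in>X. \<exists>x. t = (+) x ` p)"

definition covering :: "(real ^ 'd) set set \<Rightarrow> real ^ 'd \<Rightarrow> (real ^ 'd) set set" where
  "covering S z = {t \<in> S. is_tile t \<and> (\<forall>i. corner t $ i \<le> z $ i \<and> z $ i < corner t $ i + L)}"

text \<open>The vicinity depends on the point only through \<open>covering\<close>; therefore the cells below, although cut
  out by a system of hyperplanes that varies from point to point, form a partition.\<close>

definition vicinity :: "(real ^ 'd) set set \<Rightarrow> real ^ 'd \<Rightarrow> (real ^ 'd) set set" where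
  "vicinity S z = {t \<in> S. is_tile t \<and> (\<exists>s\<in>covering S z. \<forall>i. \<bar>corner s $ i - corner t $ i\<bar> < L)}"

definition cuts :: "(real ^ 'd) set set \<Rightarrow> 'd \<Rightarrow> real set" where
  "cuts P i = (\<Union>t\<in>P. {corner t $ i, corner t $ i + L})"

definition cell :: "(real ^ 'd) set set \<Rightarrow> real ^ 'd \<Rightarrow> (real ^ 'd) set" where
  "cell S z = cutbox (cuts (vicinity S z)) z"

text \<open>Both components are taken relative to the corner of the cell. This makes the code
  invariant under translation, and the cell position alone suffices to put the tiles back.\<close>

definition code :: "(real ^ 'd) set set \<Rightarrow> real ^ 'd \<Rightarrow> (real ^ 'd) set \<times> (real ^ 'd) set set" where
  "code S z = ((+) (- corner (cell S z)) ` cell S z, translate (- corner (cell S z)) (covering S z))"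

text \<open>The equivalence selects the half of the cell in which \<open>z\<close> lies, so both
  halves are treated by one formula.\<close>

definition brick where
  "brick k e S z = cell S z \<inter>
     {w. corner (cell S z) $ k + e (code S z) \<le> z $ k \<longleftrightarrow> corner (cell S z) $ k + e (code S z) \<le> w $ k}"

text \<open>If no cube contains \<open>z\<close>, there are no cuts and the cell is the whole space,
  which would ruin locality; such points are discarded. In a tiling there are none.\<close>

definition bricks where
  "bricks k e S = {closure (brick k e S z) |z. covering S z \<noteq> {}}"

lemma is_tile_compact:
  assumes "is_tile t"
  shows "compact t \<and> bounded t \<and> t \<noteq> {}"
proof -
  obtain p x where "p \<in> X" "t = (+) x ` p" using assms by (auto simp: is_tile_def)
  then have "prototile t" using X prototile_translation by (auto simp: prototile_set_def)
  then show ?thesis by (simp add: prototile_def compact_imp_bounded)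
qed

lemma is_tile_corner:
  assumes "is_tile t" "u \<in> t"
  shows "corner t $ i \<le> u $ i" "u $ i < corner t $ i + L"
proof -
  have t: "compact t" "bounded t" "t \<noteq> {}" using is_tile_compact[OF assms(1)] by auto
  show "corner t $ i \<le> u $ i" by (rule corner_le[OF t(2) assms(2)])
  obtain v where v: "v \<in> t" "v $ i = corner t $ i" using corner_attained[OF t(1,3)] by blast
  obtain p x where p: "p \<in> X" "t = (+) x ` p" using assms(1) by (auto simp: is_tile_def)
  obtain u' v' where "u = x + u'" "u' \<in> p" "v = x + v'" "v' \<in> p" using p(2) v(1) assms(2) by blast
  then show "u $ i < corner t $ i + L" using small[OF p(1), of u' v' i] v(2) by simp
qed

lemma is_tile_translation: "is_tile ((+) x ` t) \<longleftrightarrow> is_tile t"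
proof -
  have *: "is_tile ((+) y ` s)" if s: "is_tile s" for y s
  proof -
    obtain p v where p: "p \<in> X" "s = (+) v ` p" using s by (auto simp: is_tile_def)
    then have "(+) y ` s = (+) (y + v) ` p" by (simp add: image_image add.assoc)
    then show ?thesis using p(1) unfolding is_tile_def by blast
  qed
  have "(+) (- x) ` ((+) x ` t) = t" by (simp add: image_image)
  then show ?thesis using *[of t x] *[of "(+) x ` t" "- x"] by auto
qed

lemma tilings_is_tile: "T \<in> tilings X \<Longrightarrow> t \<in> T \<Longrightarrow> is_tile t"
  by (simp add: tilings_def is_tile_def)

lemma corner_tile_translation: "is_tile t \<Longrightarrow> corner ((+) x ` t) = x + corner t"
  using corner_translation[of t x] is_tile_compact[of t] by simp

lemma covering_subset_vicinity: "covering S z \<subseteq> vicinity S z"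
proof
  fix t assume t: "t \<in> covering S z"
  moreover have "\<forall>i. \<bar>corner t $ i - corner t $ i\<bar> < L" using L_pos by simp
  moreover have "t \<in> S" "is_tile t" using t by (simp_all add: covering_def)
  ultimately show "t \<in> vicinity S z" unfolding vicinity_def by blast
qed

lemma covering_iff: "t \<in> covering S z \<longleftrightarrow>
    t \<in> S \<and> is_tile t \<and> (\<forall>i. corner t $ i \<le> z $ i \<and> z $ i < corner t $ i + L)"
  by (simp add: covering_def)

text \<open>The cuts contain both faces of each cube in the vicinity, so \<open>z\<close> and
  \<open>w\<close> lie in the same ones of these cubes. What remains is to exclude a cube that
  contains \<open>w\<close> but is outside the vicinity of \<open>z\<close>.\<close>

lemma cell_cong:
  assumes ne: "covering S z \<noteq> {}" and w: "w \<in> cell S z"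
  shows "covering S w = covering S z" "vicinity S w = vicinity S z" "cell S w = cell S z"
proof -
  have same: "corner t $ i \<le> w $ i \<longleftrightarrow> corner t $ i \<le> z $ i"
    "corner t $ i + L \<le> w $ i \<longleftrightarrow> corner t $ i + L \<le> z $ i"
    if "t \<in> vicinity S z" for t i
  proof -
    have "corner t $ i \<in> cuts (vicinity S z) i" "corner t $ i + L \<in> cuts (vicinity S z) i"
      using that by (auto simp: cuts_def)
    then show "corner t $ i \<le> w $ i \<longleftrightarrow> corner t $ i \<le> z $ i"
      "corner t $ i + L \<le> w $ i \<longleftrightarrow> corner t $ i + L \<le> z $ i"
      using w unfolding cell_def cutbox_def by blast+
  qed
  have iff: "t \<in> covering S w \<longleftrightarrow> t \<in> covering S z" if "t \<in> vicinity S z" for t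
    using same[OF that] by (simp add: covering_iff flip: not_le)
  \<comment> \<open>The cubes of \<open>t\<close> and of some \<open>s\<close> covering
    \<open>z\<close> share the point \<open>w\<close>, so their corners differ by less than
    \<open>L\<close> in each coordinate. This is the origin of the bound in
    \<open>vicinity\<close>.\<close>
  have "t \<in> vicinity S z" if t: "t \<in> covering S w" for t
  proof -
    obtain s where s: "s \<in> covering S z" using ne by blast
    then have "s \<in> covering S w" using iff covering_subset_vicinity by blast
    then have "\<bar>corner s $ i - corner t $ i\<bar> < L" for i
      using t unfolding covering_iff by (smt (verit))
    moreover have "t \<in> S" "is_tile t" using t by (simp_all add: covering_iff)
    ultimately show ?thesis using s unfolding vicinity_def by blast
  qed
  then show covering: "covering S w = covering S z" using iff covering_subset_vicinity by blast
  then show vicinity: "vicinity S w = vicinity S z" unfolding vicinity_def by simp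
  show "cell S w = cell S z" using cutbox_eq w unfolding cell_def vicinity by blast
qed

lemma code_cong:
  assumes "covering S z \<noteq> {}" "w \<in> cell S z"
  shows "code S w = code S z"
  unfolding code_def cell_cong[OF assms] ..

lemma self_in_cell: "z \<in> cell S z"
  by (simp add: cell_def self_in_cutbox)

lemma self_in_brick: "z \<in> brick k e S z"
  by (simp add: brick_def self_in_cell)

lemma brick_cong:
  assumes ne: "covering S z \<noteq> {}" and w: "w \<in> brick k e S z"
  shows "brick k e S w = brick k e S z"
proof -
  have c: "w \<in> cell S z" using w by (simp add: brick_def)
  show ?thesis using w unfolding brick_def cell_cong(3)[OF ne c] code_cong[OF ne c] by auto
qed

section \<open>Equivariance of cells, codes and bricks\<close>

lemma covering_translation: "covering (translate x S) (x + z) = translate x (covering S z)"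
proof -
  have "(+) x ` t \<in> covering (translate x S) (x + z) \<longleftrightarrow> t \<in> covering S z" if "t \<in> S" for t
    using that by (auto simp: covering_iff is_tile_translation corner_tile_translation translate_def)
  then show ?thesis unfolding translate_def covering_def by blast
qed

lemma vicinity_translation: "vicinity (translate x S) (x + z) = translate x (vicinity S z)"
proof -
  have iff: "(+) x ` t \<in> vicinity (translate x S) (x + z) \<longleftrightarrow> t \<in> vicinity S z" if t: "t \<in> S" for t
  proof (cases "is_tile t")
    case True
    have c: "corner ((+) x ` s) = x + corner s" if "s \<in> covering S z" for s
      using that corner_tile_translation by (simp add: covering_iff)
    have "(\<exists>s\<in>translate x (covering S z). \<forall>i. \<bar>corner s $ i - (x + corner t) $ i\<bar> < L) \<longleftrightarrow>
        (\<exists>s\<in>covering S z. \<forall>i. \<bar>corner s $ i - corner t $ i\<bar> < L)"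
      by (simp add: translate_def c cong: bex_cong)
    moreover have "(+) x ` t \<in> translate x S" using t by (simp add: translate_def)
    ultimately show ?thesis
      using t True
      by (simp add: vicinity_def covering_translation is_tile_translation corner_tile_translation)
  qed (simp add: vicinity_def is_tile_translation)
  show ?thesis
  proof (intro equalityI subsetI)
    fix t' assume t': "t' \<in> vicinity (translate x S) (x + z)"
    then have "t' \<in> translate x S" by (simp add: vicinity_def)
    then obtain t where t: "t \<in> S" "t' = (+) x ` t" by (auto simp: translate_def)
    then show "t' \<in> translate x (vicinity S z)" using iff t' by (auto simp: translate_def)
  next
    fix t' assume "t' \<in> translate x (vicinity S z)"
    then obtain t where t: "t \<in> vicinity S z" "t' = (+) x ` t" by (auto simp: translate_def)
    then have "t \<in> S" by (simp add: vicinity_def)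
    then show "t' \<in> vicinity (translate x S) (x + z)" using iff t by blast
  qed
qed

lemma cuts_translation:
  assumes "\<And>t. t \<in> P \<Longrightarrow> is_tile t"
  shows "cuts (translate x P) i = (+) (x $ i) ` cuts P i"
proof -
  have "cuts (translate x P) i = (\<Union>t\<in>P. {corner ((+) x ` t) $ i, corner ((+) x ` t) $ i + L})"
    by (simp add: cuts_def translate_def)
  also have "\<dots> = (\<Union>t\<in>P. (+) (x $ i) ` {corner t $ i, corner t $ i + L})"
    by (rule SUP_cong) (simp_all add: corner_tile_translation assms add.assoc)
  also have "\<dots> = (+) (x $ i) ` cuts P i" unfolding cuts_def by (rule image_UN[symmetric])
  finally show ?thesis .
qed

lemma vicinity_is_tile: "t \<in> vicinity S z \<Longrightarrow> is_tile t"
  by (simp add: vicinity_def)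

lemma cell_translation: "cell (translate x S) (x + z) = (+) x ` cell S z"
  unfolding cell_def vicinity_translation
  by (rule cutbox_translation) (rule cuts_translation[OF vicinity_is_tile])

text \<open>The whole cell lies in the cube of any one tile covering \<open>z\<close>.\<close>

lemma cell_bound:
  assumes "covering S z \<noteq> {}" "w \<in> cell S z"
  shows "\<bar>w $ i - z $ i\<bar> < L"
proof -
  obtain t where "t \<in> covering S z" using assms(1) by blast
  moreover from this have "t \<in> covering S w" using cell_cong(1)[OF assms] by simp
  ultimately show ?thesis unfolding covering_iff by (smt (verit))
qed

text \<open>Per coordinate, a covering corner is within \<open>L\<close> of \<open>z\<close>, a
  vicinity corner within another \<open>L\<close> of that, and a tile extends less than
  \<open>L\<close> from its corner. The factor \<open>CARD('d)\<close> passes to the Euclidean norm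
  through the sum of coordinates.\<close>

definition reach :: real where "reach = CARD('d) * (3 * L)"

lemma in_reach:
  assumes "\<And>i. \<bar>u $ i - z $ i\<bar> \<le> 3 * L"
  shows "u \<in> cball (z :: real ^ 'd) reach"
proof -
  have "norm (u - z) \<le> (\<Sum>i\<in>UNIV. \<bar>(u - z) $ i\<bar>)" by (rule norm_le_l1_cart)
  also have "\<dots> \<le> of_nat (card (UNIV :: 'd set)) * (3 * L)"
    by (rule sum_bounded_above) (use assms in simp)
  finally show ?thesis by (simp add: reach_def dist_norm norm_minus_commute)
qed

lemma cell_subset_cball: "covering S z \<noteq> {} \<Longrightarrow> cell S z \<subseteq> cball z reach"
proof (intro subsetI in_reach)
  fix w i assume "covering S z \<noteq> {}" "w \<in> cell S z"
  then show "\<bar>w $ i - z $ i\<bar> \<le> 3 * L" using cell_bound[of S z w i] L_pos by linarith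
qed

lemma corner_cell_translation:
  assumes "covering S z \<noteq> {}"
  shows "corner ((+) x ` cell S z) = x + corner (cell S z)"
proof (rule corner_translation)
  show "bounded (cell S z)" by (rule bounded_subset[OF bounded_cball cell_subset_cball[OF assms]])
  show "cell S z \<noteq> {}" using self_in_cell by blast
qed

lemma code_translation:
  assumes "covering S z \<noteq> {}"
  shows "code (translate x S) (x + z) = code S z"
  unfolding code_def cell_translation covering_translation corner_cell_translation[OF assms]
  by (simp add: translate_translate image_image)

lemma brick_translation:
  assumes "covering S z \<noteq> {}"
  shows "brick k e (translate x S) (x + z) = (+) x ` brick k e S z"
proof -
  have inter: "(+) x ` A \<inter> {w. P w} = (+) x ` (A \<inter> {w. P (x + w)})" for A and P :: "real ^ 'd \<Rightarrow> bool"
    by auto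
  show ?thesis
    unfolding brick_def cell_translation code_translation[OF assms] corner_cell_translation[OF assms] inter
    by (simp add: add.assoc)
qed

lemma bricks_translation: "bricks k e (translate x S) = translate x (bricks k e S)"
proof -
  have *: "translate x (bricks k e S) \<subseteq> bricks k e (translate x S)" for x S
  proof
    fix t assume "t \<in> translate x (bricks k e S)"
    then obtain z where z: "covering S z \<noteq> {}" "t = (+) x ` closure (brick k e S z)"
      by (auto simp: translate_def bricks_def)
    then have "t = closure (brick k e (translate x S) (x + z))"
      by (simp add: brick_translation closure_translation)
    moreover have "covering (translate x S) (x + z) \<noteq> {}"
      using z(1) unfolding covering_translation by (simp add: translate_def)
    ultimately show "t \<in> bricks k e (translate x S)" unfolding bricks_def by blast
  qed
  have "translate x (translate (- x) (bricks k e (translate x S))) \<subseteq> translate x (bricks k e S)"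
    using translate_mono[OF *[of "- x" "translate x S"], of x] by (simp add: translate_translate)
  then show ?thesis using *[of x S] by (simp add: translate_translate)
qed

section \<open>Finite range of the cutting rule\<close>

lemma covering_vicinity_local:
  assumes c: "coincide_on (cball z reach) S S'"
  shows "covering S z = covering S' z" "vicinity S z = vicinity S' z"
proof -
  have in_ball: "t \<inter> cball z reach \<noteq> {}"
    if tile: "is_tile t" and near: "\<And>i. \<bar>corner t $ i - z $ i\<bar> \<le> 2 * L" for t
  proof -
    obtain u where u: "u \<in> t" using is_tile_compact[OF tile] by blast
    have "\<bar>u $ i - z $ i\<bar> \<le> 3 * L" for i
      using is_tile_corner[OF tile u, of i] near[of i] by linarith
    then show ?thesis using u in_reach by blast
  qed
  have mem: "t \<in> S'" if "t \<in> S" "is_tile t" "\<And>i. \<bar>corner t $ i - z $ i\<bar> \<le> 2 * L"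
    "coincide_on (cball z reach) S S'" for t S S'
    using in_ball[OF that(2,3)] that(1,4) unfolding coincide_on_def by blast
  have covering_bd: "\<bar>corner t $ i - z $ i\<bar> \<le> L" if "t \<in> covering S z" for t i S
    using that unfolding covering_iff by (smt (verit))
  have 1: "covering S z \<subseteq> covering S' z" if "coincide_on (cball z reach) S S'" for S S'
  proof
    fix t assume t: "t \<in> covering S z"
    have "\<bar>corner t $ i - z $ i\<bar> \<le> 2 * L" for i using covering_bd[OF t, of i] L_pos by linarith
    then have "t \<in> S'" using mem[OF _ _ _ that, of t] t by (simp add: covering_iff)
    then show "t \<in> covering S' z" using t by (simp add: covering_iff)
  qed
  show covering: "covering S z = covering S' z" using 1[OF c] 1[OF coincide_on_sym[OF c]] by blast
  have 2: "vicinity S z \<subseteq> vicinity S' z" if "coincide_on (cball z reach) S S'" "covering S z = covering S' z" for S S'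
  proof
    fix t assume t: "t \<in> vicinity S z"
    then obtain s where s: "s \<in> covering S z" "\<And>i. \<bar>corner s $ i - corner t $ i\<bar> < L"
      unfolding vicinity_def by blast
    have "\<bar>corner t $ i - z $ i\<bar> \<le> 2 * L" for i
      using covering_bd[OF s(1), of i] s(2)[of i] by linarith
    then have "t \<in> S'" using mem[OF _ _ _ that(1), of t] t by (simp add: vicinity_def)
    then show "t \<in> vicinity S' z" using t that(2) by (simp add: vicinity_def)
  qed
  show "vicinity S z = vicinity S' z"
    using 2[OF c covering] 2[OF coincide_on_sym[OF c] covering[symmetric]] by blast
qed

lemma closure_brick_subset:
  assumes "covering S z \<noteq> {}"
  shows "closure (brick k e S z) \<subseteq> cball z reach"
proof (rule closure_minimal[OF _ closed_cball])
  show "brick k e S z \<subseteq> cball z reach"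
    using cell_subset_cball[OF assms] unfolding brick_def by (rule le_infI1)
qed

lemma reach_pos: "0 < reach"
  using L_pos by (simp add: reach_def)

text \<open>One \<open>reach\<close> leads from a point of the brick to its base point
  \<open>z\<close>, a second one from \<open>z\<close> to the tiles that determine the
  brick.\<close>

lemma bricks_local_subset:
  assumes c: "coincide_on (cball x (r + 2 * reach)) S S'"
    and t: "t \<in> bricks k e S" "t \<inter> cball x r \<noteq> {}"
  shows "t \<in> bricks k e S'"
proof -
  obtain z where z: "covering S z \<noteq> {}" "t = closure (brick k e S z)" using t(1) by (auto simp: bricks_def)
  obtain u where u: "u \<in> t" "dist x u \<le> r" using t(2) by auto
  have "dist z u \<le> reach" using closure_brick_subset[OF z(1), of k e] u(1) z(2) by auto
  then have "dist x z \<le> r + reach" using u(2) dist_triangle[of x z u] by (simp add: dist_commute)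
  then have "cball z reach \<subseteq> cball x (r + 2 * reach)"
    by (simp add: cball_subset_cball_iff dist_commute)
  then have c': "coincide_on (cball z reach) S S'" by (rule coincide_on_mono[OF c])
  have "brick k e S z = brick k e S' z"
    unfolding brick_def code_def cell_def covering_vicinity_local[OF c'] ..
  then show ?thesis using z covering_vicinity_local(1)[OF c'] unfolding bricks_def by auto
qed

lemma local_derivation_bricks: "local_derivation (bricks k e) (2 * reach)"
  unfolding local_derivation_def
proof (intro conjI allI impI)
  show "0 \<le> 2 * reach" using reach_pos by simp
  show "{} \<notin> bricks k e S" for S
  proof
    assume "{} \<in> bricks k e S"
    then obtain z where "{} = closure (brick k e S z)" unfolding bricks_def by blast
    then have "brick k e S z = {}" using closure_eq_empty by metis
    then show False using self_in_brick[of z k e S] by blast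
  qed
  show "bricks k e (translate x S) = translate x (bricks k e S)" for x S
    by (rule bricks_translation)
  show "coincide_on (cball x r) (bricks k e S) (bricks k e S')"
    if "coincide_on (cball x (r + 2 * reach)) S S'" for S S' x r
    using bricks_local_subset[OF that] bricks_local_subset[OF coincide_on_sym[OF that]]
    unfolding coincide_on_def by blast
qed

section \<open>Cells of a tiling and finiteness of their codes\<close>

lemma vicinity_reach:
  assumes t: "t \<in> vicinity S z" and u: "u \<in> t"
  shows "u \<in> cball z reach"
proof (rule in_reach)
  fix i
  obtain s where s: "s \<in> covering S z" "\<bar>corner s $ i - corner t $ i\<bar> < L"
    using t unfolding vicinity_def by blast
  have "corner s $ i \<le> z $ i" "z $ i < corner s $ i + L" using s(1) by (auto simp: covering_iff)
  moreover have "corner t $ i \<le> u $ i" "u $ i < corner t $ i + L"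
    using is_tile_corner[OF vicinity_is_tile[OF t] u] by auto
  ultimately show "\<bar>u $ i - z $ i\<bar> \<le> 3 * L" using s(2) by linarith
qed

text \<open>A tile containing \<open>z\<close> also covers it, since tiles lie inside their
  cubes.\<close>

lemma covering_nonempty:
  assumes "T \<in> tilings X"
  shows "covering T z \<noteq> {}"
proof -
  have "z \<in> \<Union>T" using assms by (simp add: tilings_def)
  then obtain t where t: "t \<in> T" "z \<in> t" by blast
  have "is_tile t" by (rule tilings_is_tile[OF assms t(1)])
  then have "t \<in> covering T z" using is_tile_corner[of t z] t by (simp add: covering_iff)
  then show ?thesis by blast
qed

lemma patch_vicinity:
  assumes "T \<in> tilings X"
  shows "patch T (vicinity T z)"
proof -
  have "t \<inter> cball z reach \<noteq> {}" if "t \<in> vicinity T z" for t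
    using is_tile_compact[OF vicinity_is_tile[OF that]] vicinity_reach[OF that] by fast
  then have "vicinity T z \<subseteq> {t \<in> T. t \<inter> cball z reach \<noteq> {}}" by (auto simp: vicinity_def)
  then show ?thesis
    using finite_subset[OF _ finite_tiles_meeting[OF X assms]] by (auto simp: patch_def)
qed

lemma finite_cuts: "finite P \<Longrightarrow> finite (cuts P i)"
  by (simp add: cuts_def)

lemma cell_hbox:
  assumes "T \<in> tilings X"
  obtains l h where "cell T z = hbox l h" "z \<in> hbox l h" "\<forall>i. l $ i < h $ i"
    "l \<in> cell T z" "corner (cell T z) = l"
proof -
  obtain t where covering: "t \<in> covering T z" using covering_nonempty[OF assms] by blast
  then have t: "t \<in> vicinity T z" using covering_subset_vicinity by blast
  have "finite (vicinity T z)" using patch_vicinity[OF assms] by (simp add: patch_def)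
  moreover have "\<exists>c\<in>cuts (vicinity T z) i. c \<le> z $ i" for i
    using t covering by (intro bexI[of _ "corner t $ i"]) (auto simp: cuts_def covering_iff)
  moreover have "\<exists>c\<in>cuts (vicinity T z) i. z $ i < c" for i
    using t covering by (intro bexI[of _ "corner t $ i + L"]) (auto simp: cuts_def covering_iff)
  ultimately obtain l h where lh: "cutbox (cuts (vicinity T z)) z = hbox l h" "z \<in> hbox l h"
    using cutbox_hbox[of "cuts (vicinity T z)" z] finite_cuts by metis
  moreover have lt: "\<forall>i. l $ i < h $ i"
    using hbox_less[OF lh(2)] by blast
  moreover have "l \<in> hbox l h" using lt by (simp add: hbox_def)
  ultimately show ?thesis using that[of l h] corner_hbox[OF lt] by (simp add: cell_def)
qed

text \<open>The vicinity is a patch of bounded diameter, so it takes finitely many forms up to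
  translation. For each form there are finitely many cells, and the covering tiles are a subset of
  it.\<close>

lemma finite_codes:
  assumes T: "T \<in> tilings X" and fpc: "finite_pattern_condition T"
  shows "finite (range (code T))"
proof -
  have "diameter (\<Union>(vicinity T z)) < 3 * reach" for z
  proof -
    have "diameter (\<Union>(vicinity T z)) \<le> 2 * reach"
    proof (rule diameter_le)
      show "\<Union>(vicinity T z) \<noteq> {} \<or> 0 \<le> 2 * reach" using reach_pos by simp
      fix v w assume "v \<in> \<Union>(vicinity T z)" "w \<in> \<Union>(vicinity T z)"
      then have "dist z v \<le> reach" "dist z w \<le> reach" using vicinity_reach by auto
      then show "norm (v - w) \<le> 2 * reach"
        using dist_triangle[of v w z] by (simp add: dist_norm norm_minus_commute)
    qed
    then show ?thesis using reach_pos by simp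
  qed
  moreover have "0 < 3 * reach" using reach_pos by simp
  ultimately obtain Q where Q: "finite Q" "\<And>z. \<exists>q\<in>Q. \<exists>x. vicinity T z = translate x q"
    using fpc patch_vicinity[OF T] unfolding finite_pattern_condition_iff by meson
  define N where "N = (\<lambda>(c :: (real ^ 'd) set, A). ((+) (- corner c) ` c, translate (- corner c) A))"
  \<comment> \<open>The models in \<open>Q\<close> are arbitrary, so the infinite ones are dropped;
    those that match a vicinity are finite.\<close>
  define C where "C = (\<Union>q\<in>{q \<in> Q. finite q}. N ` (range (cutbox (cuts q)) \<times> Pow q))"
  have "code T z \<in> C" for z
  proof -
    obtain q x where q: "q \<in> Q" "vicinity T z = translate x q" using Q(2) by blast
    \<comment> \<open>Moving \<open>T\<close> makes the vicinity equal to the model itself, and the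
      code does not change.\<close>
    define T' z' where "T' = translate (- x) T" and "z' = - x + z"
    have "vicinity T' z' = translate (- x) (vicinity T z)" unfolding T'_def z'_def by (rule vicinity_translation)
    then have vicinity: "vicinity T' z' = q" by (simp add: q translate_translate)
    have "code T z = code T' z'"
      unfolding T'_def z'_def by (rule code_translation[OF covering_nonempty[OF T], symmetric])
    also have "\<dots> = N (cutbox (cuts q) z', covering T' z')"
      by (simp add: code_def cell_def vicinity N_def)
    finally have code: "code T z = N (cutbox (cuts q) z', covering T' z')" .
    have "finite (translate (- x) (vicinity T z))"
      using patch_vicinity[OF T] by (intro finite_translate) (simp add: patch_def)
    then have "finite q" by (simp add: q translate_translate)
    moreover have "covering T' z' \<subseteq> q" using covering_subset_vicinity[of T' z'] vicinity by simp
    ultimately show ?thesis unfolding C_def code using q(1) by blast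
  qed
  moreover have "finite C"
    unfolding C_def using Q(1) by (auto intro!: finite_cartesian_product finite_range_cutbox finite_cuts)
  ultimately show ?thesis by (meson finite_subset image_subsetI)
qed

section \<open>Marking cells and recovering the tiling\<close>

definition left_part :: "'d \<Rightarrow> ((real ^ 'd) set \<times> (real ^ 'd) set set \<Rightarrow> real) \<Rightarrow>
    (real ^ 'd) set \<times> (real ^ 'd) set set \<Rightarrow> (real ^ 'd) set" where
  "left_part k e c = closure (fst c \<inter> {w. w $ k < e c})"

definition right_part :: "'d \<Rightarrow> ((real ^ 'd) set \<times> (real ^ 'd) set set \<Rightarrow> real) \<Rightarrow>
    (real ^ 'd) set \<times> (real ^ 'd) set set \<Rightarrow> (real ^ 'd) set" where
  "right_part k e c = closure (fst c \<inter> {w. e c \<le> w $ k})"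

text \<open>Each translate of a left part found in \<open>S\<close> announces a cell with code
  \<open>c\<close> whose corner is at \<open>v\<close>; the tiles stored in \<open>c\<close> are
  placed there. The list \<open>C\<close> is fixed beforehand, so the rule applies to every
  collection.\<close>

definition unbrick where
  "unbrick k e C S = {t. \<exists>c\<in>C. \<exists>v. (+) v ` left_part k e c \<in> S \<and> t \<in> translate v (snd c)}"

text \<open>The last condition makes every right part wider than every left part.\<close>

definition separating where
  "separating k e T \<longleftrightarrow> (\<forall>z. 0 < e (code T z)) \<and> inj_on e (range (code T)) \<and>
     (\<forall>z z' l h. cell T z = hbox l h \<longrightarrow> e (code T z) + e (code T z') < h $ k - l $ k)"

lemma ex_separating:
  assumes T: "T \<in> tilings X" and fin: "finite (range (code T))"
  obtains e where "separating k e T"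
proof -
  \<comment> \<open>The width of a cell in direction \<open>k\<close> is a function of its code,
    because the code contains the cell up to translation. Finitely many codes thus give a positive
    least width.\<close>
  have "\<exists>d>0. \<forall>z l h. code T z = c \<longrightarrow> cell T z = hbox l h \<longrightarrow> d = h $ k - l $ k"
    if c: "c \<in> range (code T)" for c
  proof -
    obtain z where z: "c = code T z" using c by blast
    obtain l h where lh: "cell T z = hbox l h" "\<forall>i. l $ i < h $ i" "corner (cell T z) = l"
      using cell_hbox[OF T] by metis
    show ?thesis
    proof (intro exI[of _ "h $ k - l $ k"] conjI allI impI)
      show "0 < h $ k - l $ k" using lh(2) by simp
      fix z' l1 h1 assume z': "code T z' = c" "cell T z' = hbox l1 h1"
      obtain l2 h2 where lh2: "cell T z' = hbox l2 h2" "\<forall>i. l2 $ i < h2 $ i" "corner (cell T z') = l2"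
        using cell_hbox[OF T] by metis
      have "z' \<in> hbox l1 h1" using z' self_in_cell[of z' T] by simp
      then have lt1: "\<forall>i. l1 $ i < h1 $ i" using hbox_less by blast
      then have "l1 = l2 \<and> h1 = h2" using hbox_inject lh2 z'(2) by metis
      moreover have "fst (code T z') = fst (code T z)" using z z' by simp
      then have "hbox (- l2 + l2) (- l2 + h2) = hbox (- l + l) (- l + h)"
        unfolding code_def fst_conv lh(3) lh2(3) unfolding lh(1) lh2(1) hbox_translation .
      then have "- l2 + h2 = - l + h"
        using hbox_inject[of "- l2 + l2" "- l2 + h2" "- l + l" "- l + h"] lh(2) lh2(2) by simp
      then have "(- l2 + h2) $ k = (- l + h) $ k" by simp
      ultimately show "h $ k - l $ k = h1 $ k - l1 $ k" by simp
    qed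
  qed
  then obtain d where d: "\<And>c. c \<in> range (code T) \<Longrightarrow> 0 < d c"
    "\<And>z l h. cell T z = hbox l h \<Longrightarrow> d (code T z) = h $ k - l $ k"
    by (metis rangeI)
  \<comment> \<open>Half of the least width: two lengths below \<open>m\<close> together stay below
    every cell width.\<close>
  define m where "m = Min (d ` range (code T)) / 2"
  have "Min (d ` range (code T)) \<in> d ` range (code T)" using fin by (intro Min_in) auto
  then obtain c where "c \<in> range (code T)" "Min (d ` range (code T)) = d c" by blast
  then have m: "0 < m" using d(1)[of c] by (simp add: m_def)
  have le: "2 * m \<le> d (code T z)" for z
  proof -
    have "Min (d ` range (code T)) \<le> d (code T z)" using fin by (intro Min_le) auto
    then show ?thesis by (simp add: m_def)
  qed
  obtain f :: "_ \<Rightarrow> nat" where f: "inj_on f (range (code T))"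
    using finite_imp_inj_to_nat_seg[OF fin] by blast
  \<comment> \<open>Distinct values for distinct numbers \<open>f c\<close>; the summand 2 keeps
    them strictly below \<open>m\<close> also when \<open>f c = 0\<close>.\<close>
  define e where "e c = m / (real (f c) + 2)" for c
  have e: "0 < e c" "e c < m" for c using m by (auto simp: e_def divide_less_eq)
  have "inj_on e (range (code T))"
  proof (rule inj_onI)
    fix a b assume ab: "a \<in> range (code T)" "b \<in> range (code T)" "e a = e b"
    then have "f a = f b" using m by (simp add: e_def field_simps)
    then show "a = b" using f ab by (meson inj_onD)
  qed
  moreover have "e (code T z) + e (code T z') < h $ k - l $ k" if "cell T z = hbox l h" for z z' l h
    using e(2)[of "code T z"] e(2)[of "code T z'"] le[of z] d(2)[OF that] by linarith
  ultimately have "separating k e T" using e(1) by (simp add: separating_def)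
  then show ?thesis by (rule that)
qed

lemma brick_cases:
  assumes T: "T \<in> tilings X" and e: "separating k e T"
  obtains l h a where "cell T z = hbox l h" "\<forall>i. l $ i < h $ i" "corner (cell T z) = l" "z \<in> hbox l h"
    "a = l $ k + e (code T z)" "l $ k < a" "a < h $ k"
    "(+) l ` left_part k e (code T z) = cbox l (upd h k a)"
    "(+) l ` right_part k e (code T z) = cbox (upd l k a) h"
    "brick k e T z = (if z $ k < a then hbox l (upd h k a) else hbox (upd l k a) h)"
    "closure (brick k e T z) = (if z $ k < a then cbox l (upd h k a) else cbox (upd l k a) h)"
proof -
  obtain l h where lh: "cell T z = hbox l h" "z \<in> hbox l h" "\<forall>i. l $ i < h $ i" "corner (cell T z) = l"
    using cell_hbox[OF T] by metis
  define a where "a = l $ k + e (code T z)"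
  have "0 < e (code T z)" using e by (simp add: separating_def)
  moreover have "e (code T z) + e (code T z) < h $ k - l $ k"
    using e lh(1) unfolding separating_def by blast
  ultimately have a: "l $ k < a" "a < h $ k" by (auto simp: a_def)
  have lt: "\<forall>i. l $ i < upd h k a $ i" "\<forall>i. upd l k a $ i < h $ i" using a lh(3) by (simp_all add: upd_nth)
  note cut = hbox_cut[OF a]
  have "brick k e T z = hbox l h \<inter> {w. a \<le> z $ k \<longleftrightarrow> a \<le> w $ k}"
    unfolding brick_def lh(4) unfolding lh(1) a_def ..
  then have b: "brick k e T z = (if z $ k < a then hbox l (upd h k a) else hbox (upd l k a) h)"
    using cut by (simp add: not_le)
  then have c: "closure (brick k e T z) = (if z $ k < a then cbox l (upd h k a) else cbox (upd l k a) h)"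
    using closure_hbox[OF lt(1)] closure_hbox[OF lt(2)] by simp
  have fst: "fst (code T z) = (+) (- l) ` hbox l h"
    unfolding code_def fst_conv lh(4) unfolding lh(1) ..
  have inter: "A \<inter> {w. P w} = (+) (- x) ` ((+) x ` A \<inter> {w. P (w - x)})"
    for x A and P :: "real ^ 'd \<Rightarrow> bool"
    by force
  have "fst (code T z) \<inter> {w. w $ k < e (code T z)} = (+) (- l) ` (hbox l h \<inter> {w. w $ k < a})"
    by (subst inter[of _ _ l]) (simp add: fst image_image a_def algebra_simps)
  then have L: "left_part k e (code T z) = (+) (- l) ` cbox l (upd h k a)"
    unfolding left_part_def cut by (simp only: closure_translation closure_hbox[OF lt(1)])
  have "fst (code T z) \<inter> {w. e (code T z) \<le> w $ k} = (+) (- l) ` (hbox l h \<inter> {w. a \<le> w $ k})"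
    by (subst inter[of _ _ l]) (simp add: fst image_image a_def algebra_simps)
  then have R: "right_part k e (code T z) = (+) (- l) ` cbox (upd l k a) h"
    unfolding right_part_def cut by (simp only: closure_translation closure_hbox[OF lt(2)])
  show ?thesis
    by (rule that[OF lh(1,3,4,2) a_def a _ _ b c]) (simp_all add: L R image_image)
qed

lemma unbrick_bricks:
  assumes T: "T \<in> tilings X" and e: "separating k e T"
  shows "unbrick k e (range (code T)) (bricks k e T) = T"
proof (intro equalityI subsetI)
  fix t assume t: "t \<in> T"
  \<comment> \<open>A tile is recovered from the cell at its own corner, a point that its cube
    certainly contains.\<close>
  define z0 where "z0 = corner t"
  obtain l h where lh: "cell T z0 = hbox l h" "\<forall>i. l $ i < h $ i" "l \<in> cell T z0" "corner (cell T z0) = l"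
    using cell_hbox[OF T] by metis
  have "t \<in> covering T z0" using t tilings_is_tile[OF T t] L_pos by (simp add: covering_iff z0_def)
  moreover have covering: "covering T l = covering T z0" and cell: "cell T l = cell T z0" and code: "code T l = code T z0"
    using cell_cong[OF covering_nonempty[OF T] lh(3)] code_cong[OF covering_nonempty[OF T] lh(3)] by auto
  moreover have "snd (code T l) = translate (- l) (covering T l)"
    unfolding code_def snd_conv cell lh(4) ..
  ultimately have tl: "t \<in> translate l (snd (code T l))" by (simp add: translate_translate)
  obtain l' h' a where b: "cell T l = hbox l' h'" "corner (cell T l) = l'" "l' $ k < a"
    "(+) l' ` left_part k e (code T l) = cbox l' (upd h' k a)"
    "closure (brick k e T l) = (if l $ k < a then cbox l' (upd h' k a) else cbox (upd l' k a) h')"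
    using brick_cases[OF T e, of l] by metis
  \<comment> \<open>The cell corner \<open>l\<close> lies below the cut, so the brick based at
    \<open>l\<close> is the left half.\<close>
  have "l' = l" using b(2) cell lh(4) by simp
  then have "(+) l ` left_part k e (code T l) = closure (brick k e T l)" using b(3,4,5) by simp
  then have "(+) l ` left_part k e (code T l) \<in> bricks k e T"
    using covering_nonempty[OF T, of l] unfolding bricks_def by blast
  then show "t \<in> unbrick k e (range (code T)) (bricks k e T)"
    using tl unfolding unbrick_def by blast
next
  fix t assume "t \<in> unbrick k e (range (code T)) (bricks k e T)"
  then obtain z1 v z where v: "(+) v ` left_part k e (code T z1) = closure (brick k e T z)"
    and t: "t \<in> translate v (snd (code T z1))"
    unfolding unbrick_def bricks_def by blast
  obtain l1 h1 a1 where b1: "cell T z1 = hbox l1 h1" "\<forall>i. l1 $ i < h1 $ i"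
    "a1 = l1 $ k + e (code T z1)" "l1 $ k < a1" "a1 < h1 $ k"
    "(+) l1 ` left_part k e (code T z1) = cbox l1 (upd h1 k a1)"
    using brick_cases[OF T e, of z1] by metis
  obtain l h a where b: "cell T z = hbox l h" "\<forall>i. l $ i < h $ i" "corner (cell T z) = l"
    "a = l $ k + e (code T z)" "l $ k < a" "a < h $ k"
    "closure (brick k e T z) = (if z $ k < a then cbox l (upd h k a) else cbox (upd l k a) h)"
    using brick_cases[OF T e, of z] by metis
  have "(+) v ` left_part k e (code T z1) = (+) (v - l1) ` (+) l1 ` left_part k e (code T z1)"
    by (simp add: image_image)
  also have "\<dots> = cbox v (v - l1 + upd h1 k a1)"
    unfolding b1(6) cbox_translation[symmetric] by simp
  finally have eq: "cbox v (v - l1 + upd h1 k a1) = closure (brick k e T z)" using v by simp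
  have lt: "\<forall>i. v $ i < (v - l1 + upd h1 k a1) $ i" using b1(2,4) by (simp add: upd_nth)
  have ne: "cbox v (v - l1 + upd h1 k a1) \<noteq> {}"
    using box_nonempty[OF lt] box_subset_cbox by fastforce
  \<comment> \<open>If a left part equalled a right part, the cell of \<open>z\<close> would have
    width \<open>e (code T z) + e (code T z1)\<close>, which \<open>separating\<close>
    forbids.\<close>
  have "z $ k < a"
  proof (rule ccontr)
    assume "\<not> z $ k < a"
    then have "cbox v (v - l1 + upd h1 k a1) = cbox (upd l k a) h" using eq b(7) by simp
    then have "v = upd l k a" "v - l1 + upd h1 k a1 = h" using ne by (auto simp: eq_cbox)
    then have "h $ k = a + e (code T z1)" by (auto simp: upd_nth b1(3))
    moreover have "e (code T z) + e (code T z1) < h $ k - l $ k"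
      using e b(1) unfolding separating_def by blast
    ultimately show False using b(4) by simp
  qed
  then have "cbox v (v - l1 + upd h1 k a1) = cbox l (upd h k a)" using eq b(7) by simp
  then have "v = l \<and> v - l1 + upd h1 k a1 = upd h k a" using ne unfolding eq_cbox by blast
  then have vl: "v = l" "v - l1 + upd h1 k a1 = upd h k a" by blast+
  then have "(l - l1 + upd h1 k a1) $ k = upd h k a $ k" by simp
  then have "e (code T z1) = e (code T z)" by (simp add: upd_nth b1(3) b(4))
  \<comment> \<open>Equal widths give equal codes by injectivity. As the positions agree too, the
    decoded tile is one that covers \<open>z\<close>.\<close>
  then have "code T z1 = code T z" using e unfolding separating_def by (meson inj_onD rangeI)
  then have "t \<in> translate l (translate (- l) (covering T z))"
    using t by (simp add: vl(1) code_def b(3))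
  then show "t \<in> T" by (simp add: translate_translate covering_iff)
qed

lemma unbrick_translation: "unbrick k e C (translate x S) = translate x (unbrick k e C S)"
proof -
  have 1: "(+) (- x) ` (+) v ` A = (+) (v - x) ` A" for v and A :: "(real ^ 'd) set"
    by (simp add: image_image algebra_simps)
  have 2: "t \<in> translate v A \<longleftrightarrow> (+) (- x) ` t \<in> translate (v - x) A" for t v A
    unfolding mem_translate_iff[of t] mem_translate_iff[of "(+) (- x) ` t"]
    by (simp add: image_image algebra_simps)
  have "t \<in> unbrick k e C (translate x S) \<longleftrightarrow> (+) (- x) ` t \<in> unbrick k e C S" for t
  proof
    assume "t \<in> unbrick k e C (translate x S)"
    then obtain c v where "c \<in> C" "(+) v ` left_part k e c \<in> translate x S" "t \<in> translate v (snd c)"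
      unfolding unbrick_def by blast
    then have "c \<in> C" "(+) (v - x) ` left_part k e c \<in> S" "(+) (- x) ` t \<in> translate (v - x) (snd c)"
      using 1 2 mem_translate_iff by metis+
    then show "(+) (- x) ` t \<in> unbrick k e C S" unfolding unbrick_def by blast
  next
    assume "(+) (- x) ` t \<in> unbrick k e C S"
    then obtain c v where "c \<in> C" "(+) v ` left_part k e c \<in> S" "(+) (- x) ` t \<in> translate v (snd c)"
      unfolding unbrick_def by blast
    moreover have "v = (v + x) - x" by simp
    ultimately have "c \<in> C" "(+) (v + x) ` left_part k e c \<in> translate x S" "t \<in> translate (v + x) (snd c)"
      using 1 2 mem_translate_iff by metis+
    then show "t \<in> unbrick k e C (translate x S)" unfolding unbrick_def by blast
  qed
  then show ?thesis using mem_translate_iff by blast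
qed

text \<open>A left part contains the origin, so its translate by \<open>v\<close> contains
  \<open>v\<close>. Cell corner and stored tiles are each within \<open>reach\<close> of the base
  point, hence a decoded tile stays within \<open>2 * reach\<close> of \<open>v\<close>.\<close>

lemma local_derivation_unbrick:
  assumes T: "T \<in> tilings X" and e: "separating k e T"
  shows "local_derivation (unbrick k e (range (code T))) (2 * reach)"
proof -
  let ?C = "range (code T)"
  have zero: "0 \<in> left_part k e c" if "c \<in> ?C" for c
  proof -
    obtain z where z: "c = code T z" using \<open>c \<in> ?C\<close> by blast
    obtain l h a where b: "\<forall>i. l $ i < h $ i" "l $ k < a" "(+) l ` left_part k e (code T z) = cbox l (upd h k a)"
      using brick_cases[OF T e, of z] by metis
    have "l \<in> cbox l (upd h k a)" using b(1,2) by (simp add: mem_box_cart upd_nth less_imp_le)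
    then have "l \<in> (+) l ` left_part k e c" using b(3) z by simp
    then obtain w where "w \<in> left_part k e c" "l = l + w" by blast
    then show ?thesis by simp
  qed
  have near: "norm u \<le> 2 * reach" if c: "c \<in> ?C" and t: "t \<in> snd c" and u: "u \<in> t" for c t u
  proof -
    obtain z where z: "c = code T z" using c by blast
    obtain l where l: "l \<in> cell T z" "corner (cell T z) = l" using cell_hbox[OF T] by metis
    obtain s where s: "s \<in> covering T z" "t = (+) (- l) ` s"
      using t unfolding z code_def snd_conv l(2) translate_def by blast
    obtain w where w: "w \<in> s" "u = - l + w" using u s(2) by blast
    have "dist z w \<le> reach" using vicinity_reach[of s T z w] s(1) w(1) covering_subset_vicinity by auto
    moreover have "dist z l \<le> reach"
      using cell_subset_cball[OF covering_nonempty[OF T], of z] l(1) by auto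
    ultimately have "dist w l \<le> 2 * reach" using dist_triangle[of w l z] by (simp add: dist_commute)
    then show ?thesis by (simp add: w(2) dist_norm)
  qed
  have ne: "{} \<notin> snd c" if c: "c \<in> ?C" for c
  proof
    assume "{} \<in> snd c"
    then obtain z where "{} \<in> covering T z" using c by (auto simp: code_def translate_def)
    then show False using is_tile_compact by (auto simp: covering_iff)
  qed
  have sub: "t \<in> unbrick k e ?C S'"
    if co: "coincide_on (cball x (r + 2 * reach)) S S'"
      and t: "t \<in> unbrick k e ?C S" "t \<inter> cball x r \<noteq> {}" for x r S S' t
  proof -
    obtain c v where c: "c \<in> ?C" "(+) v ` left_part k e c \<in> S" "t \<in> translate v (snd c)"
      using t(1) unfolding unbrick_def by blast
    obtain s where s: "s \<in> snd c" "t = (+) v ` s" using c(3) by (auto simp: translate_def)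
    obtain u where u: "u \<in> s" "dist x (v + u) \<le> r" using t(2) s(2) by auto
    have "dist x v \<le> r + 2 * reach"
      using near[OF c(1) s(1) u(1)] u(2) dist_triangle[of x v "v + u"] by (simp add: dist_norm)
    then have "v \<in> cball x (r + 2 * reach)" by simp
    moreover have "v + 0 \<in> (+) v ` left_part k e c" using zero[OF c(1)] by blast
    ultimately have "(+) v ` left_part k e c \<inter> cball x (r + 2 * reach) \<noteq> {}" by auto
    then have "(+) v ` left_part k e c \<in> S'" using co c(2) unfolding coincide_on_def by blast
    then show ?thesis using c(1,3) unfolding unbrick_def by blast
  qed
  show ?thesis
    unfolding local_derivation_def
  proof (intro conjI allI impI)
    show "0 \<le> 2 * reach" using reach_pos by simp
    show "{} \<notin> unbrick k e ?C S" for S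
    proof
      assume "{} \<in> unbrick k e ?C S"
      then obtain c v where c: "c \<in> ?C" "{} \<in> translate v (snd c)" unfolding unbrick_def by blast
      then have "{} \<in> snd c" by (auto simp: translate_def)
      then show False using ne[OF c(1)] by blast
    qed
    show "unbrick k e ?C (translate x S) = translate x (unbrick k e ?C S)" for x S
      by (rule unbrick_translation)
    show "coincide_on (cball x r) (unbrick k e ?C S) (unbrick k e ?C S')"
      if "coincide_on (cball x (r + 2 * reach)) S S'" for S S' x r
      using sub[OF that] sub[OF coincide_on_sym[OF that]] unfolding coincide_on_def by blast
  qed
qed

section \<open>The bricks as a tiling by finitely many rectangles\<close>

definition at_origin :: "(real ^ 'd) set \<Rightarrow> (real ^ 'd) set" where
  "at_origin t = (+) (- corner t) ` t"

lemma at_origin_cbox: "\<forall>i. l $ i < h $ i \<Longrightarrow> at_origin (cbox l h) = cbox 0 (h - l)"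
  using cbox_translation[of "- l" l h] by (simp add: at_origin_def corner_cbox)

lemma at_origin_translation:
  assumes "bounded t" "t \<noteq> {}"
  shows "at_origin ((+) x ` t) = at_origin t"
  unfolding at_origin_def corner_translation[OF assms] by (simp add: image_image)

lemma bricks_cbox:
  assumes T: "T \<in> tilings X" and e: "separating k e T" and t: "t \<in> bricks k e T"
  obtains l h where "\<forall>i. l $ i < h $ i" "t = cbox l h"
    "\<exists>c\<in>range (code T). at_origin t = at_origin (left_part k e c) \<or> at_origin t = at_origin (right_part k e c)"
proof -
  obtain z where z: "t = closure (brick k e T z)" using t unfolding bricks_def by blast
  obtain l h a where b: "\<forall>i. l $ i < h $ i" "l $ k < a" "a < h $ k"
    "(+) l ` left_part k e (code T z) = cbox l (upd h k a)"
    "(+) l ` right_part k e (code T z) = cbox (upd l k a) h"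
    "closure (brick k e T z) = (if z $ k < a then cbox l (upd h k a) else cbox (upd l k a) h)"
    using brick_cases[OF T e, of z] by metis
  have nrm: "at_origin (cbox l' h') = at_origin A"
    if A: "(+) l ` A = cbox l' h'" and lt: "\<forall>i. l' $ i < h' $ i" for A l' h'
  proof -
    have A': "A = (+) (- l) ` cbox l' h'" by (simp add: A[symmetric] image_image)
    have "cbox l' h' \<noteq> {}" using box_nonempty[OF lt] box_subset_cbox by fastforce
    then show ?thesis unfolding A' using at_origin_translation[OF bounded_cbox] by metis
  qed
  have lt: "\<forall>i. l $ i < upd h k a $ i" "\<forall>i. upd l k a $ i < h $ i" using b(1-3) by (simp_all add: upd_nth)
  show ?thesis
  proof (cases "z $ k < a")
    case True
    then have "t = cbox l (upd h k a)" using b(6) z by simp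
    then show ?thesis using that[OF lt(1)] nrm[OF b(4) lt(1)] by blast
  next
    case False
    then have "t = cbox (upd l k a) h" using b(6) z by simp
    then show ?thesis using that[OF lt(2)] nrm[OF b(5) lt(2)] by blast
  qed
qed

text \<open>Moving the corner of each brick to the origin picks one representative per translation
  class. These are left and right parts of finitely many codes, up to translation, and none is a
  proper translate of another since all have corner 0.\<close>

lemma bricks_tiling:
  assumes T: "T \<in> tilings X" and e: "separating k e T" and fin: "finite (range (code T))"
  shows "prototile_set (at_origin ` bricks k e T)" "\<forall>p\<in>at_origin ` bricks k e T. rectangle p"
    "bricks k e T \<in> tilings (at_origin ` bricks k e T)"
proof -
  let ?B = "bricks k e T"
  have nb: "\<exists>d. (\<forall>i. 0 < d $ i) \<and> p = cbox 0 d" if p: "p \<in> at_origin ` ?B" for p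
  proof -
    obtain t where t: "t \<in> ?B" "p = at_origin t" using p by blast
    obtain l h where lh: "\<forall>i. l $ i < h $ i" "t = cbox l h" using bricks_cbox[OF T e t(1)] by metis
    then have "p = cbox 0 (h - l)" using t(2) at_origin_cbox by simp
    then show ?thesis using lh(1) by (intro exI[of _ "h - l"]) simp
  qed
  have "at_origin ` ?B \<subseteq> (\<Union>c\<in>range (code T). {at_origin (left_part k e c), at_origin (right_part k e c)})"
  proof
    fix p assume "p \<in> at_origin ` ?B"
    then obtain t where t: "t \<in> ?B" "p = at_origin t" by blast
    have "\<exists>c\<in>range (code T). at_origin t = at_origin (left_part k e c) \<or> at_origin t = at_origin (right_part k e c)"
      using bricks_cbox[OF T e t(1)] by metis
    then show "p \<in> (\<Union>c\<in>range (code T). {at_origin (left_part k e c), at_origin (right_part k e c)})"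
      using t(2) by blast
  qed
  moreover have "finite (\<Union>c\<in>range (code T). {at_origin (left_part k e c), at_origin (right_part k e c)})"
    using fin by (intro finite_UN_I) auto
  ultimately have "finite (at_origin ` ?B)" by (rule finite_subset)
  moreover have "prototile p" if p: "p \<in> at_origin ` ?B" for p
  proof -
    obtain d where "\<forall>i. 0 < d $ i" "p = cbox 0 d" using nb[OF p] by blast
    then show ?thesis using prototile_cbox[of 0 d] by simp
  qed
  moreover have "p = q" if p: "p \<in> at_origin ` ?B" "q \<in> at_origin ` ?B" and q: "q = (+) x ` p" for p q x
  proof -
    have c: "corner p = 0" "bounded p" "p \<noteq> {}" if p: "p \<in> at_origin ` ?B" for p
    proof -
      obtain d where d: "\<forall>i. 0 < d $ i" "p = cbox 0 d" using nb[OF p] by blast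
      then show "corner p = 0" "bounded p" using corner_cbox[of 0 d] by simp_all
      show "p \<noteq> {}" using d box_nonempty[of 0 d] box_subset_cbox by fastforce
    qed
    have "x = 0" using corner_translation[OF c(2,3)[OF p(1)], of x] c(1)[OF p(1)] c(1)[OF p(2)] q by simp
    then show ?thesis using q by simp
  qed
  ultimately show "prototile_set (at_origin ` ?B)" unfolding prototile_set_def by blast
  show "\<forall>p\<in>at_origin ` ?B. rectangle p"
  proof
    fix p assume "p \<in> at_origin ` ?B"
    then obtain d where "\<forall>i. 0 < d $ i" "p = cbox 0 d" using nb by blast
    then show "rectangle p" using rectangle_cbox[of 0 d] by simp
  qed
  have cover: "\<Union>?B = UNIV"
  proof -
    have "z \<in> \<Union>?B" for z
      using self_in_brick[of z k e T] closure_subset covering_nonempty[OF T, of z] unfolding bricks_def by blast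
    then show ?thesis by blast
  qed
  \<comment> \<open>An interior point of the closed brick lies in the half-open one. The half-open
    bricks form a partition, so closed bricks with overlapping interiors coincide.\<close>
  have int: "interior (closure (brick k e T z)) \<subseteq> brick k e T z" for z
  proof -
    obtain l h a where b:
      "brick k e T z = (if z $ k < a then hbox l (upd h k a) else hbox (upd l k a) h)"
      "closure (brick k e T z) = (if z $ k < a then cbox l (upd h k a) else cbox (upd l k a) h)"
      using brick_cases[OF T e, of z] by metis
    show ?thesis
      using interior_cbox_subset_hbox[of l "upd h k a"] interior_cbox_subset_hbox[of "upd l k a" h]
      unfolding b(2) unfolding b(1) by simp
  qed
  have disj: "interior s \<inter> interior t = {}" if st: "s \<in> ?B" "t \<in> ?B" "s \<noteq> t" for s t
  proof (rule ccontr)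
    assume ne: "interior s \<inter> interior t \<noteq> {}"
    obtain y z where yz: "s = closure (brick k e T y)" "t = closure (brick k e T z)"
      using st unfolding bricks_def by blast
    then obtain w where w: "w \<in> brick k e T y" "w \<in> brick k e T z" using ne int by blast
    then have "brick k e T y = brick k e T z"
      using brick_cong[OF covering_nonempty[OF T] w(1)] brick_cong[OF covering_nonempty[OF T] w(2)] by simp
    then show False using yz st(3) by simp
  qed
  have cl: "closure (interior t) = t" if t: "t \<in> ?B" for t
  proof -
    obtain l h where "\<forall>i. l $ i < h $ i" "t = cbox l h" using bricks_cbox[OF T e t] by metis
    then show ?thesis using prototile_cbox[of l h] by (simp add: prototile_def)
  qed
  \<comment> \<open>A disjoint family of open sets is countable, and a brick is recovered from its
    interior by closure.\<close>
  have "countable (interior ` ?B)"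
  proof (rule countable_disjoint_open_subsets)
    show "disjoint (interior ` ?B)" unfolding disjoint_def using disj by blast
  qed auto
  moreover have "inj_on interior ?B" using cl by (metis inj_onI)
  ultimately have "countable ?B" by (rule countable_image_inj_on)
  moreover have "\<exists>p\<in>at_origin ` ?B. \<exists>x. t = (+) x ` p" if t: "t \<in> ?B" for t
  proof (intro bexI exI)
    show "t = (+) (corner t) ` at_origin t" by (simp add: at_origin_def image_image)
  qed (use t in blast)
  ultimately show "?B \<in> tilings (at_origin ` ?B)"
    unfolding tilings_def using cover disj by blast
qed

end

theorem theorem1p14:
  fixes X :: "(real ^ 'd) set set" and T :: "(real ^ 'd) set set"
  assumes "prototile_set X" and "T \<in> tilings X" and "perfect T"
  shows "\<exists>(X' :: (real ^ 'd) set set) T'. prototile_set X' \<and> (\<forall>p\<in>X'. rectangle p) \<and>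
    T' \<in> tilings X' \<and> perfect T' \<and> hull_equivalent X T X' T'"
proof -
  have "bounded (\<Union>X)"
    using assms(1) by (auto simp: prototile_set_def prototile_def intro!: bounded_Union compact_imp_bounded)
  then obtain b where b: "0 < b" "\<And>u. u \<in> \<Union>X \<Longrightarrow> norm u \<le> b" unfolding bounded_pos by blast
  \<comment> \<open>Coordinates of points of prototiles differ by at most \<open>2 * b\<close>; the
    added 1 makes the bound strict.\<close>
  interpret brick_cutting X "2 * b + 1"
  proof
    show "prototile_set X" by (rule assms(1))
    show "0 < 2 * b + 1" using b(1) by simp
    fix p u v i assume "p \<in> X" "u \<in> p" "v \<in> p"
    then have "\<bar>u $ i\<bar> \<le> b" "\<bar>v $ i\<bar> \<le> b"
      using b(2) component_le_norm_cart order_trans by blast+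
    then show "u $ i - v $ i < 2 * b + 1" by linarith
  qed
  have fpc: "finite_pattern_condition T" using assms(3) by (simp add: perfect_def)
  have fin: "finite (range (code T))" by (rule finite_codes[OF assms(2) fpc])
  \<comment> \<open>Any coordinate axis serves for the marking cut; the goal does not mention
    \<open>k\<close>.\<close>
  fix k :: 'd
  obtain e where e: "separating k e T" using ex_separating[OF assms(2) fin] by blast
  note B = bricks_tiling[OF assms(2) e fin]
  note F = local_derivation_bricks[of k e]
  note G = local_derivation_unbrick[OF assms(2) e]
  note GF = unbrick_bricks[OF assms(2) e]
  show ?thesis
    using B perfect_derivation[where F = "bricks k e", OF assms(1,2) B(1,3) F G GF assms(3)]
      hull_equivalent_of_derivations[where F = "bricks k e", OF assms(1,2) B(1,3) F G GF]
    by blast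
qed
end
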